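(* For all integers $k\geq 0$, we have $$\sum_{n=0}^\infty A_4\left(3^{2k+1}n+\frac{3^{2k+2}-5}{4}\right)q^n = \frac{3^{2k+2}-1}{4}\cdot\frac{f_2^{12}}{f_1^6}+\frac{27(3^{2k}-1)(3^{2k+2}-1)}{320}\left(3\frac{f_2^2f_3^{10}}{f_1^4f_6^2}+4q\frac{f_3f_6^7}{f_1f_2}\right)+3^{2k+2}\cdot\frac{q^3f_{12}^8}{f_3^2}.$$
   Context: For a complex number $q$ with $|q|<1$ (or as formal power series in $q$) and an integer $m\geq 1$, put $f_m := \prod_{n=1}^\infty (1-q^{mn})$. A partition is $4$-core if none of the hook lengths in its Ferrers--Young diagram is divisible by $4$. $A_4(n)$ denotes the number of partition pairs of $n$ with $4$-cores, i.e. pairs of partitions $(\lambda,\mu)$, both $4$-core, such that the sum of all parts of $\lambda$ and $\mu$ is $n$ (with $A_4(0)=1$). Its generating function is $\sum_{n=0}^\infty A_4(n)q^n = f_4^8/f_1^2$. *)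

theory Defs
  imports "HOL-Analysis.Infinite_Products" "HOL-Computational_Algebra.Formal_Power_Series"
begin

text \<open>A partition is the list of its parts in weakly decreasing order.\<close>

definition is_partition :: "nat list \<Rightarrow> bool" where
  "is_partition xs \<longleftrightarrow> sorted_wrt (\<ge>) xs \<and> 0 \<notin> set xs"

text \<open>Rows and columns are numbered from 0.\<close>

definition cells :: "nat list \<Rightarrow> (nat \<times> nat) set" where
  "cells xs = {(i, j). i < length xs \<and> j < xs ! i}"

definition hook :: "nat list \<Rightarrow> nat \<Rightarrow> nat \<Rightarrow> (nat \<times> nat) set" where
  "hook xs i j = {(i', j') \<in> cells xs. i' = i \<and> j \<le> j' \<or> j' = j \<and> i \<le> i'}"

definition hook_length :: "nat list \<Rightarrow> nat \<Rightarrow> nat \<Rightarrow> nat" where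
  "hook_length xs i j = card (hook xs i j)"

definition is_core :: "nat \<Rightarrow> nat list \<Rightarrow> bool" where
  "is_core t xs \<longleftrightarrow> is_partition xs \<and> (\<forall>(i, j) \<in> cells xs. \<not> t dvd hook_length xs i j)"

definition core_pairs :: "nat \<Rightarrow> nat \<Rightarrow> (nat list \<times> nat list) set" where
  "core_pairs t n =
     {(xs, ys). is_core t xs \<and> is_core t ys \<and> sum_list xs + sum_list ys = n}"

definition A4 :: "nat \<Rightarrow> nat" where
  "A4 n = card (core_pairs 4 n)"

text \<open>The product is taken in the usual topology of formal power series; for \<open>m \<ge> 1\<close> it
  converges, as shown by \<open>euler_f_has_prod\<close> below. The index is shifted since \<open>\<Prod>n. _\<close> starts at 0.\<close>

definition euler_f :: "nat \<Rightarrow> complex fps" where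
  "euler_f m = (\<Prod>n. 1 - fps_X ^ (m * (n + 1)))"

lemma finite_cells: "finite (cells xs)"
proof -
  have "cells xs = (SIGMA i:{..<length xs}. {..<xs ! i})"
    by (auto simp: cells_def)
  then show ?thesis by simp
qed

lemma finite_hook: "finite (hook xs i j)"
  by (rule finite_subset[OF _ finite_cells[of xs]]) (auto simp: hook_def)

lemma finite_core_pairs: "finite (core_pairs t n)"
proof -
  let ?L = "{xs. set xs \<subseteq> {..n} \<and> length xs \<le> n}"
  have len: "length xs \<le> sum_list xs" if "0 \<notin> set xs" for xs :: "nat list"
    using that by (induction xs) auto
  have L: "xs \<in> ?L" if "is_partition xs" "sum_list xs \<le> n" for xs
  proof -
    have "x \<le> n" if "x \<in> set xs" for x
      using member_le_sum_list[OF that] \<open>sum_list xs \<le> n\<close> by linarith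
    moreover have "length xs \<le> n"
      using len[of xs] that by (simp add: is_partition_def)
    ultimately show ?thesis by auto
  qed
  have "core_pairs t n \<subseteq> ?L \<times> ?L"
  proof (rule subsetI)
    fix p assume "p \<in> core_pairs t n"
    then obtain xs ys where p: "p = (xs, ys)" "is_partition xs" "is_partition ys"
      "sum_list xs + sum_list ys = n"
      by (auto simp: core_pairs_def is_core_def)
    then have "xs \<in> ?L" "ys \<in> ?L" by (intro L; simp)+
    then show "p \<in> ?L \<times> ?L" unfolding p(1) by (rule SigmaI)
  qed
  moreover have "finite ?L" by (intro finite_lists_length_le) simp
  ultimately show ?thesis by (meson finite_SigmaI finite_subset)
qed

lemma A4_0: "A4 0 = 1"
proof -
  have "core_pairs 4 0 = {([], [])}"
  proof -
    have "xs = []" if "0 \<notin> set xs" "sum_list xs = 0" for xs :: "nat list"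
      using that by (cases xs) auto
    then show ?thesis
      by (auto simp: core_pairs_def is_core_def is_partition_def cells_def)
  qed
  then show ?thesis by (simp add: A4_def)
qed

lemma euler_f_has_prod:
  assumes "m \<ge> 1"
  shows "(\<lambda>n. 1 - fps_X ^ (m * (n + 1))) has_prod euler_f m"
    and "fps_nth (euler_f m) 0 = 1"
proof -
  let ?g = "\<lambda>n. 1 - fps_X ^ (m * (n + 1)) :: complex fps"
  let ?P = "\<lambda>n. \<Prod>i\<le>n. ?g i"
  define p where "p = Abs_fps (\<lambda>k. fps_nth (?P k) k)"
  have step: "fps_nth (?P (Suc n)) k = fps_nth (?P n) k" if "k \<le> n" for n k
  proof -
    have "k < m * (n + 2)"
      using assms that by (metis add_2_eq_Suc' le_imp_less_Suc less_SucI less_le_trans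
          mult_le_mono1 nat_mult_1)
    then have "fps_nth (fps_X ^ (m * (n + 2)) * ?P n) k = 0"
      by (simp only: fps_X_power_mult_nth if_True)
    moreover have "?P (Suc n) = ?P n - fps_X ^ (m * (n + 2)) * ?P n"
      by (simp add: algebra_simps)
    ultimately show ?thesis by simp
  qed
  have stable: "fps_nth (?P n) k = fps_nth (?P k) k" if "k \<le> n" for n k
    using that by (induction n rule: dec_induct) (use step in auto)
  have lim: "?P \<longlonglongrightarrow> p"
  proof (rule tendsto_fpsI)
    fix k
    show "\<forall>\<^sub>F n in sequentially. fps_nth (?P n) k = fps_nth p k"
      using eventually_ge_at_top[of k] by eventually_elim (unfold p_def fps_nth_Abs_fps, rule stable)
  qed
  have p0: "fps_nth p 0 = 1"
    using assms by (simp add: p_def)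
  then have "p \<noteq> 0" by auto
  with lim have hp: "?g has_prod p"
    by (simp add: has_prod_def raw_has_prod_def)
  then have eq: "euler_f m = p"
    unfolding euler_f_def by (rule has_prod_unique[symmetric])
  show "?g has_prod euler_f m" using hp eq by simp
  show "fps_nth (euler_f m) 0 = 1" using p0 eq by simp
qed

text \<open>Neither the subtraction nor the division on type \<open>nat\<close> in \<open>(3 ^ (2 * k + 2) - 5) div 4\<close> truncates.\<close>

lemma shift_exact:
  fixes k :: nat
  shows "4 * ((3 ^ (2 * k + 2) - 5) div 4) + 5 = (3 ^ (2 * k + 2) :: nat)"
proof -
  have "\<exists>c. (3 ^ (2 * k + 2) :: nat) = 4 * c + 5"
  proof (induction k)
    case 0
    show ?case by (intro exI[of _ 1]) simp
  next
    case (Suc k)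
    then obtain c where c: "(3 ^ (2 * k + 2) :: nat) = 4 * c + 5" by blast
    have "(3 ^ (2 * Suc k + 2) :: nat) = 9 * 3 ^ (2 * k + 2)"
      by (simp add: power_add)
    also have "\<dots> = 4 * (9 * c + 10) + 5" using c by simp
    finally show ?case by blast
  qed
  then show ?thesis by auto
qed

end

theory Submission
  imports Defs
begin

text \<open>
  Write \<open>\<psi>(q)\<close> for the sum of \<open>q ^ (j (j + 1) / 2)\<close> over \<open>j \<ge> 0\<close>. The generating function of the pairs of
  4-cores is \<open>P(q) = \<psi>(q)\<^sup>2 \<psi>(q\<^sup>2)\<^sup>4\<close> (\<open>A4_generating_function\<close>): on an abacus with four runners a 4-core has
  its beads pushed down on every runner, so it amounts to a vector of four runner shifts with sum 0; its
  size is a quadratic polynomial in the shifts, and a linear change of coordinates turns the associated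
  theta series into \<open>\<psi>(q) \<psi>(q\<^sup>2)\<^sup>2\<close>.

  The passage from \<open>k\<close> to \<open>k + 1\<close> in the theorem extracts the coefficients at the places \<open>9 n + 6\<close>, an
  operator \<open>U\<close> on power series, and the case \<open>k = 0\<close> extracts those of \<open>P\<close> at the places \<open>3 n + 1\<close>. With \<open>H\<close>
  the bracket in the theorem, the following relations hold.
    \<^item> The coefficients of \<open>P\<close> at the places \<open>3 n + 1\<close> form \<open>2 \<psi>(q)\<^sup>6 + 9 q\<^sup>3 P(q\<^sup>3)\<close>
      (\<open>section3_1_core_pair_series\<close>), and \<open>U\<close> maps \<open>q\<^sup>3 P(q\<^sup>3)\<close> to the same series.
    \<^item> \<open>U\<close> maps \<open>\<psi>\<^sup>6\<close> to \<open>\<psi>\<^sup>6 + 27 H\<close> (\<open>section9_psi_6\<close>).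
    \<^item> \<open>U\<close> maps \<open>H\<close> to \<open>81 H\<close> (\<open>section9_eigen_series\<close>).
  Thus \<open>U\<close> preserves the span of \<open>\<psi>\<^sup>6\<close>, \<open>H\<close> and \<open>q\<^sup>3 P(q\<^sup>3)\<close>, and the three
  coefficients in the theorem solve a triangular linear recurrence. The formula
  \<open>\<psi>(q) = f\<^sub>2\<^sup>2 / f\<^sub>1\<close> translates \<open>\<psi>\<^sup>6\<close> and \<open>P(q\<^sup>3)\<close> into the quotients of the statement.

  The relations are proved by dissecting \<open>\<psi>(q) = A(q\<^sup>3) + q B(q\<^sup>3)\<close> and \<open>\<psi>(q\<^sup>2) = C(q\<^sup>3) + q\<^sup>2 D(q\<^sup>3)\<close>, where
  \<open>A(q) = f(q, q\<^sup>2)\<close> is a theta function of Ramanujan, \<open>B(q) = \<psi>(q\<^sup>3)\<close>, and \<open>C\<close> and \<open>D\<close> arise from \<open>A\<close> and \<open>B\<close> by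
  squaring \<open>q\<close>. Extracting coefficients from a polynomial in \<open>\<psi>(q)\<close> and \<open>\<psi>(q\<^sup>2)\<close> gives a polynomial in \<open>A\<close>,
  \<open>B\<close>, \<open>C\<close>, \<open>D\<close>, so it suffices to know the algebraic relations between these series. They
  follow from the dissection of \<open>\<phi>(q)\<close> modulo 3 and from three facts. Two are theta identities, proved by splitting index lattices into cosets:
  \<open>\<psi>(q)\<^sup>2 = \<phi>(q) \<psi>(q\<^sup>2)\<close> and \<open>\<phi>(q) \<psi>(q) = A C + 2 q B D\<close>, where \<open>\<phi>(q)\<close> is the sum of \<open>q ^ (j\<^sup>2)\<close>
  over all integers \<open>j\<close>. The third is \<open>\<psi>(q)\<^sup>4 = A\<^sup>3 B + q B\<^sup>4\<close> (\<open>cubic_psi\<close>), obtained by multiplying the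
  product formula of \<open>\<psi>\<close> over the three cube roots of unity. The product formulas for \<open>\<psi>\<close> and \<open>A\<close> come
  from Jacobi's triple product.
\<close>

unbundle no vec_syntax
unbundle fps_syntax
declare One_nat_def [simp del]

section \<open>Theta series\<close>

text \<open>A theta series is stored through its coefficients, as a counting function, instead of as an
infinite sum: an identity between theta series then becomes a bijection between index sets.\<close>

definition theta :: "'a set \<Rightarrow> ('a \<Rightarrow> int) \<Rightarrow> complex fps" where
  "theta S Q = Abs_fps (\<lambda>n. of_nat (card {v \<in> S. Q v = int n}))"

text \<open>These two conditions let counting behave additively and multiplicatively: an infinite fibre would
have cardinality 0, and values below 0 would be lost in a power series.\<close>

definition admissible :: "'a set \<Rightarrow> ('a \<Rightarrow> int) \<Rightarrow> bool" where
  "admissible S Q \<longleftrightarrow> (\<forall>v\<in>S. 0 \<le> Q v) \<and> (\<forall>n. finite {v \<in> S. Q v = n})"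

lemma theta_nth: "theta S Q $ n = of_nat (card {v \<in> S. Q v = int n})"
  by (simp add: theta_def)

lemma admissible_finite: "admissible S Q \<Longrightarrow> finite {v \<in> S. Q v = n}"
  by (simp add: admissible_def)

lemma admissible_nonneg: "admissible S Q \<Longrightarrow> v \<in> S \<Longrightarrow> 0 \<le> Q v"
  by (simp add: admissible_def)

lemma admissible_subset:
  assumes "admissible T Q" "S \<subseteq> T"
  shows "admissible S Q"
proof -
  have "finite {v \<in> S. Q v = n}" for n
    by (rule finite_subset[OF _ admissible_finite[OF assms(1), of n]]) (use assms(2) in auto)
  then show ?thesis
    using assms admissible_nonneg unfolding admissible_def by blast
qed

lemma admissible_int:
  assumes "\<And>j::int. \<bar>j\<bar> \<le> Q j"
  shows "admissible UNIV Q"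
proof -
  have "finite {j. Q j = n}" for n
  proof (rule finite_subset)
    show "{j. Q j = n} \<subseteq> {- n..n}"
    proof
      fix j assume "j \<in> {j. Q j = n}"
      with assms[of j] show "j \<in> {- n..n}" by simp linarith
    qed
  qed simp
  moreover have "0 \<le> Q j" for j
    using assms[of j] by linarith
  ultimately show ?thesis
    by (simp add: admissible_def)
qed

lemma admissible_Times:
  assumes "admissible S Q" "admissible T R"
  shows "admissible (S \<times> T) (\<lambda>(v, w). Q v + R w)"
proof -
  have "finite {p \<in> S \<times> T. (case p of (v, w) \<Rightarrow> Q v + R w) = n}" for n
  proof -
    have "{p \<in> S \<times> T. (case p of (v, w) \<Rightarrow> Q v + R w) = n}
      \<subseteq> (\<Union>m\<in>{0..n}. {v \<in> S. Q v = m} \<times> {w \<in> T. R w = n - m})"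
    proof
      fix p assume "p \<in> {p \<in> S \<times> T. (case p of (v, w) \<Rightarrow> Q v + R w) = n}"
      then obtain v w where p: "p = (v, w)" "v \<in> S" "w \<in> T" "Q v + R w = n" by auto
      have "0 \<le> Q v" "0 \<le> R w" using assms p by (simp_all add: admissible_nonneg)
      with p have "p \<in> {v' \<in> S. Q v' = Q v} \<times> {w \<in> T. R w = n - Q v}" "Q v \<in> {0..n}" by auto
      then show "p \<in> (\<Union>m\<in>{0..n}. {v \<in> S. Q v = m} \<times> {w \<in> T. R w = n - m})" by blast
    qed
    then show ?thesis
      by (rule finite_subset) (use assms in \<open>simp add: admissible_finite\<close>)
  qed
  moreover have "\<forall>p\<in>S \<times> T. 0 \<le> (case p of (v, w) \<Rightarrow> Q v + R w)"
    using assms by (auto simp: admissible_nonneg)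
  ultimately show ?thesis
    unfolding admissible_def by blast
qed

lemma theta_bij:
  assumes "bij_betw g S T" "\<And>v. v \<in> S \<Longrightarrow> Q (g v) = R v"
  shows "theta S R = theta T Q"
proof -
  have "card {v \<in> S. R v = int n} = card {w \<in> T. Q w = int n}" for n
  proof (rule bij_betw_same_card)
    have "g ` {v \<in> S. R v = int n} = {w \<in> g ` S. Q w = int n}"
      using assms(2) by auto
    then show "bij_betw g {v \<in> S. R v = int n} {w \<in> T. Q w = int n}"
      using assms(1) unfolding bij_betw_def by (auto intro: inj_on_subset)
  qed
  then show ?thesis by (simp add: theta_def)
qed

lemma theta_range:
  assumes "inj g" "\<And>v. Q (g v) = R v"
  shows "theta (range g) Q = theta UNIV R"
  using theta_bij[of g UNIV "range g" Q R] assms by (simp add: bij_betw_def)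

lemma theta_Un:
  assumes "admissible (S \<union> T) Q" "S \<inter> T = {}"
  shows "theta (S \<union> T) Q = theta S Q + theta T Q"
proof (rule fps_ext)
  fix n
  have "{v \<in> S \<union> T. Q v = int n} = {v \<in> S. Q v = int n} \<union> {v \<in> T. Q v = int n}"
    by auto
  moreover have "card \<dots> = card {v \<in> S. Q v = int n} + card {v \<in> T. Q v = int n}"
  proof (rule card_Un_disjoint)
    show "finite {v \<in> S. Q v = int n}" "finite {v \<in> T. Q v = int n}"
      by (rule admissible_finite, rule admissible_subset[OF assms(1)], blast)+
  qed (use assms(2) in blast)
  ultimately show "theta (S \<union> T) Q $ n = (theta S Q + theta T Q) $ n"
    by (simp add: theta_nth)
qed

lemma theta_mult:
  assumes "admissible S Q" "admissible T R"
  shows "theta S Q * theta T R = theta (S \<times> T) (\<lambda>(v, w). Q v + R w)"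
proof (rule fps_ext)
  fix n
  let ?F = "\<lambda>m. {v \<in> S. Q v = int m} \<times> {w \<in> T. R w = int (n - m)}"
  have "{p \<in> S \<times> T. (case p of (v, w) \<Rightarrow> Q v + R w) = int n} = (\<Union>m\<in>{0..n}. ?F m)" (is "?L = ?R")
  proof
    show "?L \<subseteq> ?R"
    proof
      fix p assume "p \<in> ?L"
      then obtain v w where p: "p = (v, w)" "v \<in> S" "w \<in> T" "Q v + R w = int n" by auto
      have "0 \<le> Q v" "0 \<le> R w" using assms p by (simp_all add: admissible_nonneg)
      with p have "p \<in> ?F (nat (Q v))" "nat (Q v) \<in> {0..n}" by auto
      then show "p \<in> ?R" by blast
    qed
    show "?R \<subseteq> ?L" by auto
  qed
  moreover have "card (\<Union>m\<in>{0..n}. ?F m) = (\<Sum>m\<in>{0..n}. card (?F m))"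
  proof (rule card_UN_disjoint)
    show "\<forall>i\<in>{0..n}. finite (?F i)" using assms by (simp add: admissible_finite)
  qed auto
  ultimately show "(theta S Q * theta T R) $ n = theta (S \<times> T) (\<lambda>(v, w). Q v + R w) $ n"
    by (simp add: theta_nth fps_mult_nth card_cartesian_product)
qed

lemma theta_shift:
  assumes "admissible S Q"
  shows "theta S (\<lambda>v. Q v + int c) = fps_X ^ c * theta S Q"
proof (rule fps_ext)
  fix n
  show "theta S (\<lambda>v. Q v + int c) $ n = (fps_X ^ c * theta S Q) $ n"
  proof (cases "n < c")
    case True
    have "Q v + int c \<noteq> int n" if "v \<in> S" for v
      using admissible_nonneg[OF assms that] True by linarith
    then have "{v \<in> S. Q v + int c = int n} = {}" by blast
    then show ?thesis using True by (simp only: theta_nth fps_X_power_mult_nth) simp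
  next
    case False
    then have "{v \<in> S. Q v + int c = int n} = {v \<in> S. Q v = int (n - c)}" by auto
    with False show ?thesis by (simp add: theta_nth fps_X_power_mult_nth)
  qed
qed

abbreviation dilate :: "nat \<Rightarrow> complex fps \<Rightarrow> complex fps" where
  "dilate m F \<equiv> fps_compose F (fps_X ^ m)"

lemma dilate_nth:
  assumes "m > 0"
  shows "dilate m F $ n = (if m dvd n then F $ (n div m) else 0)"
proof -
  have "dilate m F $ n = (\<Sum>i=0..n. F $ i * (fps_X ^ (m * i)) $ n)"
    by (simp only: fps_compose_nth power_mult)
  also have "\<dots> = (\<Sum>i\<in>{i. i \<le> n \<and> n = m * i}. F $ i)"
    by (rule sum.mono_neutral_cong_right) auto
  also have "{i. i \<le> n \<and> n = m * i} = (if m dvd n then {n div m} else {})"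
    using assms by (auto elim!: dvdE)
  finally show ?thesis by simp
qed

lemma dilate_theta:
  assumes "m > 0"
  shows "dilate m (theta S Q) = theta S (\<lambda>v. int m * Q v)"
proof (rule fps_ext)
  fix n
  show "dilate m (theta S Q) $ n = theta S (\<lambda>v. int m * Q v) $ n"
  proof (cases "m dvd n")
    case True
    then obtain k where "n = m * k" ..
    with assms show ?thesis by (simp add: theta_nth dilate_nth)
  next
    case False
    have "int m * Q v \<noteq> int n" for v
      using False by (metis dvd_triv_left int_dvd_int_iff)
    with False assms show ?thesis by (simp add: theta_nth dilate_nth)
  qed
qed

lemma dilate_rules:
  assumes "m > 0"
  shows "dilate m (F + G) = dilate m F + dilate m G" "dilate m (F - G) = dilate m F - dilate m G"
    "dilate m (F * G) = dilate m F * dilate m G" "dilate m (F ^ k) = dilate m F ^ k"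
    "dilate m fps_X = fps_X ^ m" "dilate m (numeral u) = numeral u" "dilate m 1 = 1"
  using assms by (simp_all add: fps_compose_add_distrib fps_compose_sub_distrib
      fps_compose_mult_distrib fps_compose_power)

lemma dilate_dilate:
  assumes "m > 0" "k > 0"
  shows "dilate m (dilate k F) = dilate (m * k) F"
  using assms by (subst fps_compose_assoc[symmetric]) (simp_all add: fps_X_power_compose flip: power_mult)

text \<open>With these exponents, \<open>ramanujan_f a b\<close> is Ramanujan's theta function \<open>f(q ^ a, q ^ b)\<close>.\<close>

definition theta_exp :: "nat \<Rightarrow> nat \<Rightarrow> int \<Rightarrow> int" where
  "theta_exp a b j = (int a + int b) * (j * (j - 1) div 2) + int a * j"

definition ramanujan_f :: "nat \<Rightarrow> nat \<Rightarrow> complex fps" where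
  "ramanujan_f a b = theta UNIV (theta_exp a b)"

lemma two_theta_exp: "2 * theta_exp a b j = (int a + int b) * (j * (j - 1)) + 2 * int a * j"
proof -
  have "2 * (j * (j - 1) div 2) = j * (j - 1)" by simp
  then have "2 * ((int a + int b) * (j * (j - 1) div 2)) = (int a + int b) * (j * (j - 1))"
    by (metis mult.left_commute)
  then show ?thesis
    unfolding theta_exp_def by (simp only: distrib_left mult.assoc)
qed

text \<open>The growth estimate that makes every fibre of the exponent finite; it follows from the symmetric form
\<open>a j (j + 1) / 2 + b j (j - 1) / 2\<close> of the exponent.\<close>

lemma abs_le_theta_exp:
  assumes "a \<ge> 1" "b \<ge> 1"
  shows "\<bar>j\<bar> \<le> theta_exp a b j"
proof -
  have *: "0 \<le> i * (i - 1)" for i :: int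
    by (cases "i \<le> 0") (auto simp: zero_le_mult_iff)
  have "2 * theta_exp a b j = int a * (j * (j + 1)) + int b * (j * (j - 1))"
    by (simp add: two_theta_exp algebra_simps)
  moreover have "1 * (j * (j + 1)) \<le> int a * (j * (j + 1))"
    by (rule mult_right_mono) (use assms *[of "j + 1"] in \<open>simp_all add: mult.commute\<close>)
  moreover have "1 * (j * (j - 1)) \<le> int b * (j * (j - 1))"
    by (rule mult_right_mono) (use assms *[of "j"] in \<open>simp_all add: mult.commute\<close>)
  ultimately have "2 * (j * j) \<le> 2 * theta_exp a b j" by (simp add: algebra_simps)
  moreover have "\<bar>j\<bar> \<le> j * j"
    using mult_mono[of 1 "\<bar>j\<bar>" "\<bar>j\<bar>" "\<bar>j\<bar>"] by (cases "j = 0") auto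
  ultimately show ?thesis by linarith
qed

lemma admissible_theta_exp: "a \<ge> 1 \<Longrightarrow> b \<ge> 1 \<Longrightarrow> admissible UNIV (theta_exp a b)"
  by (rule admissible_int) (rule abs_le_theta_exp)

lemma theta_exp_scale: "theta_exp (m * a) (m * b) j = int m * theta_exp a b j"
  by (simp add: theta_exp_def algebra_simps)

lemma dilate_ramanujan_f: "m > 0 \<Longrightarrow> dilate m (ramanujan_f a b) = ramanujan_f (m * a) (m * b)"
  by (simp add: ramanujan_f_def dilate_theta theta_exp_scale[abs_def])

lemma ramanujan_f_mult:
  assumes "a \<ge> 1" "b \<ge> 1" "c \<ge> 1" "d \<ge> 1"
  shows "ramanujan_f a b * ramanujan_f c d = theta UNIV (\<lambda>(i, j). theta_exp a b i + theta_exp c d j)"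
  using assms by (simp add: ramanujan_f_def theta_mult admissible_theta_exp flip: UNIV_Times_UNIV)

lemma admissible_theta_exp2:
  assumes "a \<ge> 1" "b \<ge> 1" "c \<ge> 1" "d \<ge> 1"
  shows "admissible UNIV (\<lambda>(i, j). theta_exp a b i + theta_exp c d j)"
  using assms admissible_Times[of UNIV "theta_exp a b" UNIV "theta_exp c d"]
  by (simp add: admissible_theta_exp)

lemma ramanujan_f_nth_0:
  assumes "a \<ge> 1" "b \<ge> 1"
  shows "ramanujan_f a b $ 0 = 1"
proof -
  have "theta_exp a b j = 0 \<longleftrightarrow> j = 0" for j
    using abs_le_theta_exp[OF assms, of j] by (cases "j = 0") (simp add: theta_exp_def, linarith)
  then have "{j. theta_exp a b j = 0} = {0}" by simp
  then show ?thesis by (simp add: ramanujan_f_def theta_nth)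
qed

text \<open>The way identities between theta series are proved below: the index lattice is cut into cosets, each
parametrised by an injective affine map, and the form is rewritten in the new coordinates.\<close>

lemma theta_split2:
  assumes "admissible UNIV Q" "inj g" "inj h" "\<And>x y. g x \<noteq> h y" "\<And>v. v \<in> range g \<or> v \<in> range h"
    and "\<And>v. Q (g v) = R v" "\<And>v. Q (h v) = S v"
  shows "theta UNIV Q = theta UNIV R + theta UNIV S"
proof -
  have U: "UNIV = range g \<union> range h" using assms(5) by blast
  have "theta UNIV Q = theta (range g) Q + theta (range h) Q"
    unfolding U by (rule theta_Un) (use assms(1,4) in \<open>auto simp flip: U\<close>)
  with assms show ?thesis by (simp add: theta_range[of g Q R] theta_range[of h Q S])
qed

lemma theta_split3:
  assumes "admissible UNIV Q" "inj g" "inj h" "inj k"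
    and "\<And>x y. g x \<noteq> h y" "\<And>x y. g x \<noteq> k y" "\<And>x y. h x \<noteq> k y"
    and "\<And>v. v \<in> range g \<or> v \<in> range h \<or> v \<in> range k"
    and "\<And>v. Q (g v) = R v" "\<And>v. Q (h v) = S v" "\<And>v. Q (k v) = T v"
  shows "theta UNIV Q = theta UNIV R + theta UNIV S + theta UNIV T"
proof -
  have U: "UNIV = (range g \<union> range h) \<union> range k" using assms(8) by blast
  have "theta UNIV Q = theta (range g \<union> range h) Q + theta (range k) Q"
    unfolding U by (rule theta_Un) (use assms(1,6,7) assms(6,7)[symmetric] in \<open>auto simp flip: U\<close>)
  also have "theta (range g \<union> range h) Q = theta (range g) Q + theta (range h) Q"
    by (rule theta_Un) (use assms(5) in \<open>auto intro: admissible_subset[OF assms(1)]\<close>)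
  finally show ?thesis
    using assms by (simp add: theta_range[of g Q R] theta_range[of h Q S] theta_range[of k Q T])
qed

section \<open>Theta identities from sublattices\<close>

text \<open>For \<open>psi\<close> the exponents are \<open>2 j\<^sup>2 - j\<close>, which run through the triangular numbers, each taken once, as
\<open>j\<close> runs through the integers; for \<open>phi\<close> they are the squares.\<close>

definition psi :: "complex fps" where "psi = ramanujan_f 1 3"
definition phi :: "complex fps" where "phi = ramanujan_f 1 1"

lemma theta_exp_eqI: "2 * theta_exp a b j = 2 * n \<Longrightarrow> theta_exp a b j = n"
  by simp

lemma theta_exp_1_1: "theta_exp 1 1 j = j * j"
  by (rule theta_exp_eqI) (simp add: two_theta_exp algebra_simps)

lemma theta_exp_1_2_even: "theta_exp 1 2 (2 * i) = 6 * i * i - i"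
  by (rule theta_exp_eqI) (simp add: two_theta_exp algebra_simps)

lemma theta_exp_1_2_odd: "theta_exp 1 2 (2 * i + 1) = 6 * i * i + 5 * i + 1"
  by (rule theta_exp_eqI) (simp add: two_theta_exp algebra_simps)

lemma theta_exp_1_3: "theta_exp 1 3 j = 2 * j * j - j"
  by (rule theta_exp_eqI) (simp add: two_theta_exp algebra_simps)

lemma theta_exp_1_5: "theta_exp 1 5 j = 3 * j * j - 2 * j"
  by (rule theta_exp_eqI) (simp add: two_theta_exp algebra_simps)

lemma theta_exp_scaled:
  "theta_exp 2 4 j = 2 * theta_exp 1 2 j" "theta_exp 2 6 j = 2 * theta_exp 1 3 j"
  "theta_exp 3 9 j = 3 * theta_exp 1 3 j" "theta_exp 6 18 j = 6 * theta_exp 1 3 j"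
  using theta_exp_scale[of 2 1 2] theta_exp_scale[of 2 1 3] theta_exp_scale[of 3 1 3]
    theta_exp_scale[of 6 1 3] by simp_all

lemma fps_X_mult_dilate_ramanujan_f:
  assumes "m > 0" "a \<ge> 1" "b \<ge> 1"
  shows "fps_X ^ c * dilate m (ramanujan_f a b) = theta UNIV (\<lambda>j. int m * theta_exp a b j + int c)"
proof -
  have "admissible UNIV (theta_exp (m * a) (m * b))"
    by (rule admissible_theta_exp) (use assms mult_le_mono[of 1 m 1] in auto)
  from theta_shift[OF this, of c] show ?thesis
    using assms by (simp add: ramanujan_f_def dilate_theta theta_exp_scale[abs_def])
qed

text \<open>Completing the square turns the exponent \<open>2 j\<^sup>2 - j\<close> into \<open>((4 j - 1)\<^sup>2 - 1) / 8\<close>. The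
indices with \<open>4 j - 1\<close> divisible by 3 reproduce \<open>\<psi>(q ^ 9)\<close>; for the others the exponent is
divisible by 3, and their two classes modulo 3 are the even and the odd half of \<open>f(q, q\<^sup>2)\<close>.\<close>

lemma psi_dissection: "psi = dilate 3 (ramanujan_f 1 2) + fps_X * dilate 9 psi"
proof -
  have "ramanujan_f 1 2 = theta UNIV (\<lambda>i. 6 * i * i - i) + theta UNIV (\<lambda>i. 6 * i * i + 7 * i + 2)"
    unfolding ramanujan_f_def
  proof (rule theta_split2)
    show "theta_exp 1 2 (2 * i) = 6 * i * i - i" for i
      by (rule theta_exp_1_2_even)
    show "theta_exp 1 2 (- 2 * i - 1) = 6 * i * i + 7 * i + 2" for i
      by (rule theta_exp_eqI) (simp add: two_theta_exp algebra_simps)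
    show "v \<in> range ((*) 2) \<or> v \<in> range (\<lambda>i. - 2 * i - 1)" for v :: int
      unfolding image_iff by simp presburger
    show "2 * x \<noteq> - 2 * y - 1" for x y :: int by presburger
  qed (auto simp: inj_on_def admissible_theta_exp)
  then have "dilate 3 (ramanujan_f 1 2) =
    theta UNIV (\<lambda>i. 3 * (6 * i * i - i)) + theta UNIV (\<lambda>i. 3 * (6 * i * i + 7 * i + 2))"
    by (simp add: dilate_rules dilate_theta)
  moreover have "fps_X * dilate 9 psi = theta UNIV (\<lambda>i. 9 * theta_exp 1 3 i + 1)"
    using fps_X_mult_dilate_ramanujan_f[of 9 1 3 1] by (simp add: psi_def)
  moreover have "psi = theta UNIV (\<lambda>i. 3 * (6 * i * i - i)) + theta UNIV (\<lambda>i. 3 * (6 * i * i + 7 * i + 2))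
    + theta UNIV (\<lambda>i. 9 * theta_exp 1 3 i + 1)"
    unfolding psi_def ramanujan_f_def
  proof (rule theta_split3)
    show "theta_exp 1 3 (3 * i) = 3 * (6 * i * i - i)" for i
      by (simp add: theta_exp_1_3)
    show "theta_exp 1 3 (3 * i + 2) = 3 * (6 * i * i + 7 * i + 2)" for i
      by (simp add: theta_exp_1_3 algebra_simps)
    show "theta_exp 1 3 (1 - 3 * i) = 9 * theta_exp 1 3 i + 1" for i
      by (simp add: theta_exp_1_3 algebra_simps)
    show "v \<in> range ((*) 3) \<or> v \<in> range (\<lambda>i. 3 * i + 2) \<or> v \<in> range (\<lambda>i. 1 - 3 * i)" for v :: int
      unfolding image_iff by simp presburger
    show "3 * x \<noteq> 3 * y + 2" "3 * x \<noteq> 1 - 3 * y" "3 * x + 2 \<noteq> 1 - 3 * y" for x y :: int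
      by presburger+
  qed (auto simp: inj_on_def admissible_theta_exp)
  ultimately show ?thesis by simp
qed

lemma phi_dissection: "phi = dilate 9 phi + 2 * fps_X * dilate 3 (ramanujan_f 1 5)"
proof -
  have "fps_X * dilate 3 (ramanujan_f 1 5) = theta UNIV (\<lambda>i. 3 * theta_exp 1 5 i + 1)"
    using fps_X_mult_dilate_ramanujan_f[of 3 1 5 1] by simp
  moreover have "dilate 9 phi = theta UNIV (\<lambda>i. 9 * theta_exp 1 1 i)"
    using fps_X_mult_dilate_ramanujan_f[of 9 1 1 0] by (simp add: phi_def)
  moreover have "phi = theta UNIV (\<lambda>i. 9 * theta_exp 1 1 i) + theta UNIV (\<lambda>i. 3 * theta_exp 1 5 i + 1)
     + theta UNIV (\<lambda>i. 3 * theta_exp 1 5 i + 1)"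
    unfolding phi_def ramanujan_f_def
  proof (rule theta_split3)
    show "theta_exp 1 1 (3 * i) = 9 * theta_exp 1 1 i" for i
      by (simp add: theta_exp_1_1)
    show "theta_exp 1 1 (3 * i - 1) = 3 * theta_exp 1 5 i + 1" for i
      by (simp add: theta_exp_1_1 theta_exp_1_5 algebra_simps)
    show "theta_exp 1 1 (1 - 3 * i) = 3 * theta_exp 1 5 i + 1" for i
      by (simp add: theta_exp_1_1 theta_exp_1_5 algebra_simps)
    show "v \<in> range ((*) 3) \<or> v \<in> range (\<lambda>i. 3 * i - 1) \<or> v \<in> range (\<lambda>i. 1 - 3 * i)" for v :: int
      unfolding image_iff by simp presburger
    show "3 * x \<noteq> 3 * y - 1" "3 * x \<noteq> 1 - 3 * y" "3 * x - 1 \<noteq> 1 - 3 * y" for x y :: int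
      by presburger+
  qed (auto simp: inj_on_def admissible_theta_exp)
  ultimately have "phi = dilate 9 phi + fps_X * dilate 3 (ramanujan_f 1 5)
      + fps_X * dilate 3 (ramanujan_f 1 5)"
    by simp
  then show ?thesis by (metis (no_types) add.assoc mult.assoc mult_2)
qed

text \<open>In terms of the sum \<open>s\<close> and the difference \<open>d\<close> of the two indices, the exponent is \<open>d\<^sup>2 + s (s - 1)\<close>. The
condition that \<open>s\<close> and \<open>d\<close> have the same parity leaves \<open>s = 2 e\<close> or \<open>s = 1 - 2 e\<close>, and
\<open>s (s - 1)\<close> is the same for both.\<close>

lemma psi_squared: "psi ^ 2 = phi * dilate 2 psi"
proof -
  have "psi ^ 2 = theta UNIV (\<lambda>(b, c). theta_exp 1 3 b + theta_exp 1 3 c)"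
    by (simp add: psi_def power2_eq_square ramanujan_f_mult)
  also have "\<dots> = theta UNIV (\<lambda>(i, e). 4 * i * i + 4 * e * e - 2 * e)
      + theta UNIV (\<lambda>(i, e). 4 * i * i + 4 * i + 1 + 4 * e * e - 2 * e)"
  proof (rule theta_split2)
    show "(case (case p of (i, e) \<Rightarrow> (e + i, e - i)) of (b, c) \<Rightarrow> theta_exp 1 3 b + theta_exp 1 3 c) =
       (case p of (i, e) \<Rightarrow> 4 * i * i + 4 * e * e - 2 * e)" for p
      by (cases p) (simp add: theta_exp_1_3 algebra_simps)
    show "(case (case p of (i, e) \<Rightarrow> (1 - e + i, - e - i)) of (b, c) \<Rightarrow> theta_exp 1 3 b + theta_exp 1 3 c) =
       (case p of (i, e) \<Rightarrow> 4 * i * i + 4 * i + 1 + 4 * e * e - 2 * e)" for p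
      by (cases p) (simp add: theta_exp_1_3 algebra_simps)
    show "(case x of (i, e) \<Rightarrow> (e + i, e - i)) \<noteq> (case y of (i, e) \<Rightarrow> (1 - e + i, - e - i))"
      for x y :: "int \<times> int"
      by (cases x; cases y; simp) presburger
    show "v \<in> range (\<lambda>(i, e). (e + i, e - i)) \<or> v \<in> range (\<lambda>(i, e). (1 - e + i, - e - i))"
      for v :: "int \<times> int"
      by (cases v; simp add: image_iff) presburger
  qed (auto simp: inj_on_def admissible_theta_exp2)
  also have "\<dots> = theta UNIV (\<lambda>(d, e). theta_exp 1 1 d + theta_exp 2 6 e)"
  proof (rule theta_split2[symmetric])
    show "(case (case p of (i, e) \<Rightarrow> (2 * i, e)) of (d, e) \<Rightarrow> theta_exp 1 1 d + theta_exp 2 6 e) =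
       (case p of (i, e) \<Rightarrow> 4 * i * i + 4 * e * e - 2 * e)" for p
      by (cases p) (simp add: theta_exp_1_1 theta_exp_1_3 theta_exp_scaled)
    show "(case (case p of (i, e) \<Rightarrow> (2 * i + 1, e)) of (d, e) \<Rightarrow> theta_exp 1 1 d + theta_exp 2 6 e) =
       (case p of (i, e) \<Rightarrow> 4 * i * i + 4 * i + 1 + 4 * e * e - 2 * e)" for p
      by (cases p) (simp add: theta_exp_1_1 theta_exp_1_3 theta_exp_scaled algebra_simps)
    show "(case x of (i, e) \<Rightarrow> (2 * i, e)) \<noteq> (case y of (i, e) \<Rightarrow> (2 * i + 1, e))"
      for x y :: "int \<times> int"
      by (cases x; cases y; simp) presburger
    show "v \<in> range (\<lambda>(i, e). (2 * i, e)) \<or> v \<in> range (\<lambda>(i, e). (2 * i + 1, e))"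
      for v :: "int \<times> int"
      by (cases v; simp add: image_iff) presburger
  qed (auto simp: inj_on_def admissible_theta_exp2)
  also have "\<dots> = phi * dilate 2 psi"
    by (simp add: psi_def phi_def dilate_ramanujan_f ramanujan_f_mult)
  finally show ?thesis .
qed

text \<open>With \<open>x = 2 b\<close> and \<open>y = 4 c - 1\<close> the left side counts the values of the norm form
\<open>y\<^sup>2 + 2 x\<^sup>2\<close> of \<open>\<int>[\<surd>-2]\<close>. Multiplication by \<open>1 + \<surd>-2\<close>, an element of norm 3, turns the form into
\<open>((y - 2 x)\<^sup>2 + 2 (x + y)\<^sup>2) / 3\<close>. If 3 divides both new coordinates, one gets the second summand on
the right, twice because the sign of \<open>x + y\<close> is free; if 3 divides neither, one gets the first.\<close>

lemma phi_mult_psi: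
  "phi * psi = ramanujan_f 1 2 * dilate 2 (ramanujan_f 1 2) + 2 * fps_X * (dilate 3 psi * dilate 6 psi)"
proof -
  \<comment> \<open>The four maps parametrise, in this order, the classes with b - c = 0 and b - c = 1 modulo 3 and the
      two parities of b within the class b - c = -1.\<close>
  let ?Q = "\<lambda>(b, c). theta_exp 1 1 b + theta_exp 1 3 c"
  let ?g1 = "\<lambda>(i, l). (l - 2 * i, i + l) :: int \<times> int"
  let ?g2 = "\<lambda>(i, l). (2 * i + 1 - l, - i - l) :: int \<times> int"
  let ?g3 = "\<lambda>(i, l). (2 * l + 2 * i - 1, 2 * l - i) :: int \<times> int"
  let ?g4 = "\<lambda>(i, l). (2 * i - 2 * l, 1 - 2 * l - i) :: int \<times> int"
  let ?R1 = "\<lambda>(i, l). 6 * i * i - i + 2 * theta_exp 1 2 l"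
  let ?R2 = "\<lambda>(i, l). 6 * i * i + 5 * i + 1 + 2 * theta_exp 1 2 l"
  let ?R3 = "\<lambda>(i, l). (case (i, l) of (i, l) \<Rightarrow> theta_exp 3 9 i + theta_exp 6 18 l) + int 1"
  have E: "2 * theta_exp 1 2 l = 3 * l * l - l" for l
    by (simp add: two_theta_exp algebra_simps)
  have adm: "admissible S ?Q" for S
    by (rule admissible_subset[OF admissible_theta_exp2]) auto
  have cover: "UNIV = (range ?g1 \<union> range ?g2) \<union> (range ?g3 \<union> range ?g4)"
  proof -
    have "v \<in> range ?g1 \<or> v \<in> range ?g2 \<or> v \<in> range ?g3 \<or> v \<in> range ?g4" for v :: "int \<times> int"
    proof (cases v)
      case (Pair b c)
      consider i where "b - c = - 3 * i" | i where "b - c = 3 * i + 1"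
        | i l where "b - c = 3 * i - 1" "b = 2 * l + 2 * i - 1"
        | i l where "b - c = 3 * i - 1" "b = 2 * i - 2 * l"
      proof -
        have "(\<exists>i. b - c = - 3 * i) \<or> (\<exists>i. b - c = 3 * i + 1) \<or> (\<exists>i. b - c = 3 * i - 1)"
          by presburger
        moreover have "(\<exists>l. b = 2 * l + 2 * i - 1) \<or> (\<exists>l. b = 2 * i - 2 * l)" for i
          by presburger
        ultimately show ?thesis using that by blast
      qed
      then show ?thesis
      proof cases
        case 1
        then have "v = ?g1 (i, c - i)" using Pair by simp
        then show ?thesis by blast
      next
        case 2
        then have "v = ?g2 (i, - c - i)" using Pair by simp
        then show ?thesis by blast
      next
        case 3
        then have "v = ?g3 (i, l)" using Pair by simp
        then show ?thesis by blast
      next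
        case 4
        then have "v = ?g4 (i, l)" using Pair by simp
        then show ?thesis by blast
      qed
    qed
    then show ?thesis by blast
  qed
  have g12: "range ?g1 \<inter> range ?g2 = {}"
  proof -
    have "?g1 x \<noteq> ?g2 y" for x y by (cases x; cases y; simp) presburger
    then show ?thesis by blast
  qed
  have g34: "range ?g3 \<inter> range ?g4 = {}"
  proof -
    have "?g3 x \<noteq> ?g4 y" for x y by (cases x; cases y; simp) presburger
    then show ?thesis by blast
  qed
  have disj: "(range ?g1 \<union> range ?g2) \<inter> (range ?g3 \<union> range ?g4) = {}"
  proof -
    have "?g1 x \<noteq> ?g3 y" for x y by (cases x; cases y; simp) presburger
    moreover have "?g1 x \<noteq> ?g4 y" for x y by (cases x; cases y; simp) presburger
    moreover have "?g2 x \<noteq> ?g3 y" for x y by (cases x; cases y; simp) presburger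
    moreover have "?g2 x \<noteq> ?g4 y" for x y by (cases x; cases y; simp) presburger
    ultimately show ?thesis by blast
  qed
  have t1: "theta (range ?g1) ?Q = theta UNIV ?R1"
    by (rule theta_range) (auto simp: inj_on_def theta_exp_1_1 theta_exp_1_3 E algebra_simps)
  have t2: "theta (range ?g2) ?Q = theta UNIV ?R2"
    by (rule theta_range) (auto simp: inj_on_def theta_exp_1_1 theta_exp_1_3 E algebra_simps)
  have t3: "theta (range ?g3) ?Q = theta UNIV ?R3"
    by (rule theta_range) (auto simp: inj_on_def theta_exp_1_1 theta_exp_1_3 theta_exp_scaled algebra_simps)
  have t4: "theta (range ?g4) ?Q = theta UNIV ?R3"
    by (rule theta_range) (auto simp: inj_on_def theta_exp_1_1 theta_exp_1_3 theta_exp_scaled algebra_simps)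
  have "phi * psi = theta UNIV ?Q"
    by (simp add: phi_def psi_def ramanujan_f_mult)
  also have "\<dots> = theta (range ?g1 \<union> range ?g2) ?Q + theta (range ?g3 \<union> range ?g4) ?Q"
    using theta_Un[OF adm disj] by (simp only: cover[symmetric])
  also have "theta (range ?g3 \<union> range ?g4) ?Q = theta UNIV ?R3 + theta UNIV ?R3"
    using theta_Un[OF adm g34] t3 t4 by simp
  also have "theta UNIV ?R3 = fps_X * (dilate 3 psi * dilate 6 psi)"
    using theta_shift[OF admissible_theta_exp2[of 3 9 6 18], of 1]
    by (simp add: psi_def dilate_ramanujan_f ramanujan_f_mult split_def)
  also have "theta (range ?g1 \<union> range ?g2) ?Q = theta UNIV ?R1 + theta UNIV ?R2"
    using theta_Un[OF adm g12] t1 t2 by simp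
  also have "theta UNIV ?R1 + theta UNIV ?R2 = theta UNIV (\<lambda>(j, l). theta_exp 1 2 j + theta_exp 2 4 l)"
  proof (rule theta_split2[symmetric])
    show "(case (case p of (i, e) \<Rightarrow> (2 * i, e)) of (d, e) \<Rightarrow> theta_exp 1 2 d + theta_exp 2 4 e) = ?R1 p" for p
      by (cases p) (simp add: theta_exp_1_2_even theta_exp_scaled)
    show "(case (case p of (i, e) \<Rightarrow> (2 * i + 1, e)) of (d, e) \<Rightarrow> theta_exp 1 2 d + theta_exp 2 4 e) = ?R2 p" for p
      by (cases p) (simp add: theta_exp_1_2_odd theta_exp_scaled)
    show "(case x of (i, e) \<Rightarrow> (2 * i, e)) \<noteq> (case y of (i, e) \<Rightarrow> (2 * i + 1, e))"
      for x y :: "int \<times> int"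
      by (cases x; cases y; simp) presburger
    show "v \<in> range (\<lambda>(i, e). (2 * i, e)) \<or> v \<in> range (\<lambda>(i, e). (2 * i + 1, e))"
      for v :: "int \<times> int"
      by (cases v; simp add: image_iff) presburger
  qed (auto simp: inj_on_def admissible_theta_exp2)
  also have "\<dots> = ramanujan_f 1 2 * dilate 2 (ramanujan_f 1 2)"
    by (simp add: dilate_ramanujan_f ramanujan_f_mult)
  finally show ?thesis by (simp add: algebra_simps)
qed

section \<open>Limits of power series and of finite products\<close>

definition agree :: "nat \<Rightarrow> complex fps \<Rightarrow> complex fps \<Rightarrow> bool" where
  "agree K F G \<longleftrightarrow> (\<forall>i\<le>K. F $ i = G $ i)"

lemma agree_mult: "agree K F G \<Longrightarrow> agree K F' G' \<Longrightarrow> agree K (F * F') (G * G')"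
  unfolding agree_def by (auto simp: fps_mult_nth intro!: sum.cong)

lemma agree_cancel:
  assumes "agree K (E * F) (E * G)" "E $ 0 \<noteq> 0"
  shows "agree K F G"
proof -
  have "agree K (inverse E * (E * F)) (inverse E * (E * G))"
    by (rule agree_mult[OF _ assms(1)]) (simp add: agree_def)
  moreover have "inverse E * (E * H) = H" for H
    using inverse_mult_eq_1[OF assms(2)] by (simp flip: mult.assoc)
  ultimately show ?thesis by simp
qed

lemma tendsto_iff_agree: "(F \<longlongrightarrow> G) A \<longleftrightarrow> (\<forall>K. eventually (\<lambda>x. agree K (F x) G) A)" for G :: "complex fps"
proof
  assume *: "(F \<longlongrightarrow> G) A"
  show "\<forall>K. eventually (\<lambda>x. agree K (F x) G) A"
  proof
    fix K
    have "eventually (\<lambda>x. \<forall>i\<in>{..K}. F x $ i = G $ i) A"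
      by (subst eventually_ball_finite_distrib) (use * in \<open>auto simp: tendsto_fps_iff\<close>)
    then show "eventually (\<lambda>x. agree K (F x) G) A"
      by eventually_elim (simp add: agree_def)
  qed
next
  assume *: "\<forall>K. eventually (\<lambda>x. agree K (F x) G) A"
  show "(F \<longlongrightarrow> G) A"
  proof (rule tendsto_fpsI)
    fix K
    show "eventually (\<lambda>x. F x $ K = G $ K) A"
      using *[rule_format, of K] by eventually_elim (simp add: agree_def)
  qed
qed

lemma tendsto_mult_fps:
  fixes F G :: "complex fps"
  assumes "(f \<longlongrightarrow> F) A" "(g \<longlongrightarrow> G) A"
  shows "((\<lambda>x. f x * g x) \<longlongrightarrow> F * G) A"
  unfolding tendsto_iff_agree
proof
  fix K
  have "eventually (\<lambda>x. agree K (f x) F) A" "eventually (\<lambda>x. agree K (g x) G) A"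
    using assms by (simp_all add: tendsto_iff_agree)
  then show "eventually (\<lambda>x. agree K (f x * g x) (F * G)) A"
    by eventually_elim (rule agree_mult)
qed

text \<open>The finite \<open>q\<close>-Pochhammer symbol \<open>(p; p)\<^sub>n\<close>.\<close>

definition qpoch :: "'a::comm_ring_1 \<Rightarrow> nat \<Rightarrow> 'a" where
  "qpoch p n = (\<Prod>i<n. 1 - p ^ Suc i)"

lemma qpoch_0 [simp]: "qpoch p 0 = 1"
  by (simp add: qpoch_def)

lemma qpoch_Suc: "qpoch p (Suc n) = qpoch p n * (1 - p ^ Suc n)"
  by (simp add: qpoch_def)

lemma tendsto_euler_f:
  assumes "m \<ge> 1"
  shows "(\<lambda>N. qpoch (fps_X ^ m) N) \<longlonglongrightarrow> euler_f m"
proof -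
  have "(\<lambda>N. \<Prod>i<N. 1 - fps_X ^ (m * (i + 1))) \<longlonglongrightarrow> euler_f m"
    by (rule has_prod_imp_tendsto') (rule euler_f_has_prod[OF assms])
  then show ?thesis
    unfolding qpoch_def power_mult Suc_eq_plus1 .
qed

lemma tendsto_euler_f_mult:
  assumes "m \<ge> 1" "c \<ge> 1"
  shows "(\<lambda>N. qpoch (fps_X ^ m) (c * N)) \<longlonglongrightarrow> euler_f m"
proof -
  have "filterlim (\<lambda>N. c * N) sequentially sequentially"
    by (rule filterlim_subseq) (use assms in \<open>auto simp: strict_mono_def\<close>)
  from filterlim_compose[OF tendsto_euler_f[OF assms(1)] this] show ?thesis .
qed

text \<open>Convergence with an explicit rate, as needed for limits inside a sum whose length grows.\<close>

lemma qpoch_agree: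
  assumes "m \<ge> 1" "K \<le> N"
  shows "agree K (qpoch (fps_X ^ m) N) (euler_f m)"
proof -
  have step: "agree K (qpoch (fps_X ^ m) (n + K)) (qpoch (fps_X ^ m) K)" for n
  proof (induction n)
    case (Suc n)
    have "agree K (qpoch (fps_X ^ m) (n + K) * (1 - (fps_X ^ m) ^ Suc (n + K))) (qpoch (fps_X ^ m) K * 1)"
    proof (rule agree_mult[OF Suc])
      have "K < m * Suc (n + K)"
        by (rule less_le_trans[of _ "1 * Suc (n + K)"]) (simp, rule mult_le_mono1, rule assms(1))
      then show "agree K (1 - (fps_X ^ m) ^ Suc (n + K)) 1"
        unfolding power_mult[symmetric] by (auto simp: agree_def)
    qed
    then show ?case by (simp add: qpoch_Suc del: power_Suc)
  qed (simp add: agree_def)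
  have "eventually (\<lambda>M. agree K (qpoch (fps_X ^ m) M) (euler_f m)) sequentially"
    using tendsto_euler_f[OF assms(1)] by (simp add: tendsto_iff_agree)
  then have "eventually (\<lambda>M. agree K (qpoch (fps_X ^ m) M) (euler_f m) \<and> M \<ge> K) sequentially"
    using eventually_ge_at_top[of K] by eventually_elim simp
  then obtain M where "agree K (qpoch (fps_X ^ m) M) (euler_f m)" "M \<ge> K"
    unfolding eventually_sequentially by blast
  with step[of "M - K"] step[of "N - K"] assms(2) show ?thesis
    by (simp add: agree_def)
qed

lemma dilate_euler_f:
  assumes "k \<ge> 1" "m \<ge> 1"
  shows "dilate k (euler_f m) = euler_f (k * m)"
proof (rule LIMSEQ_unique)
  have "dilate k (qpoch (fps_X ^ m) N) = qpoch (fps_X ^ (k * m)) N" for N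
  proof (induction N)
    case (Suc N)
    from assms have "k > 0" by simp
    note r = dilate_rules[OF this]
    show ?case using Suc
      by (simp add: qpoch_Suc r power_mult del: power_Suc)
  qed simp
  moreover have "(\<lambda>N. dilate k (qpoch (fps_X ^ m) N)) \<longlonglongrightarrow> dilate k (euler_f m)"
    unfolding tendsto_fps_iff
  proof
    fix n
    have "\<forall>\<^sub>F N in sequentially. qpoch (fps_X ^ m) N $ (n div k) = euler_f m $ (n div k)"
      using tendsto_euler_f[OF assms(2)] unfolding tendsto_fps_iff by blast
    then show "\<forall>\<^sub>F N in sequentially. dilate k (qpoch (fps_X ^ m) N) $ n = dilate k (euler_f m) $ n"
      by eventually_elim (use assms in \<open>simp add: dilate_nth\<close>)
  qed
  ultimately show "(\<lambda>N. qpoch (fps_X ^ (k * m)) N) \<longlonglongrightarrow> dilate k (euler_f m)"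
    by simp
  show "(\<lambda>N. qpoch (fps_X ^ (k * m)) N) \<longlonglongrightarrow> euler_f (k * m)"
    by (rule tendsto_euler_f) (use assms mult_le_mono[of 1 k 1 m] in simp)
qed

section \<open>Jacobi's triple product\<close>

text \<open>Gaussian binomial coefficients, given by one of the two Pascal rules because \<open>p\<close> ranges over a ring
without division.\<close>

fun qbin :: "'a::comm_ring_1 \<Rightarrow> nat \<Rightarrow> nat \<Rightarrow> 'a" where
  "qbin p n 0 = 1"
| "qbin p 0 (Suc m) = 0"
| "qbin p (Suc n) (Suc m) = qbin p n (Suc m) + p ^ (n - m) * qbin p n m"

lemma qbin_eq_0: "n < m \<Longrightarrow> qbin p n m = 0"
  by (induction p n m rule: qbin.induct) auto

lemma qbin_qpoch: "m \<le> n \<Longrightarrow> qbin p n m * qpoch p m * qpoch p (n - m) = qpoch p n"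
proof (induction p n m rule: qbin.induct)
  case (3 p n m)
  show ?case
  proof (cases "m = n")
    case True
    with 3(2) have "qbin p n n * qpoch p n = qpoch p n" by simp
    moreover have "qbin p (Suc n) (Suc n) * qpoch p (Suc n) = (qbin p n n * qpoch p n) * (1 - p ^ Suc n)"
      by (simp add: qbin_eq_0 qpoch_Suc mult_ac)
    ultimately show ?thesis using True by (simp add: qpoch_Suc)
  next
    case False
    with 3 have "m < n" by simp
    then obtain d where n: "n = Suc (m + d)" using less_imp_Suc_add by blast
    have 1: "qbin p n (Suc m) * qpoch p (Suc m) * qpoch p d = qpoch p n"
      using 3(1) n by simp
    have 2: "qbin p n m * qpoch p m * qpoch p (Suc d) = qpoch p n"
      using 3(2) n by (simp add: Suc_diff_le)
    have "qbin p (Suc n) (Suc m) * qpoch p (Suc m) * qpoch p (Suc d)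
      = (qbin p n (Suc m) * qpoch p (Suc m) * qpoch p d) * (1 - p ^ Suc d)
       + p ^ Suc d * (1 - p ^ Suc m) * (qbin p n m * qpoch p m * qpoch p (Suc d))"
      using n by (simp add: qpoch_Suc Suc_diff_le algebra_simps)
    also have "\<dots> = qpoch p n * (1 - p ^ (Suc d + Suc m))"
      unfolding 1 2 power_add by (simp add: algebra_simps)
    also have "Suc d + Suc m = Suc n" using n by simp
    finally show ?thesis using n by (simp add: qpoch_Suc)
  qed
qed (simp_all)

text \<open>Rothe's binomial theorem, in a homogeneous form so that no negative powers arise when it is specialised
to a product that is symmetric about its middle.\<close>

lemma rothe:
  "(\<Prod>i<n. u + v * p ^ i) = (\<Sum>m\<le>n. qbin p n m * u ^ (n - m) * v ^ m * p ^ (m choose 2))"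
proof (induction n)
  case (Suc n)
  let ?T = "\<lambda>n m. qbin p n m * u ^ (n - m) * v ^ m * p ^ (m choose 2)"
  have split: "?T (Suc n) (Suc m) = ?T n (Suc m) * u + ?T n m * (v * p ^ n)" if "m < n" for m
  proof -
    have "p ^ n = p ^ (n - m) * p ^ m" using that by (simp flip: power_add)
    moreover have "u ^ (n - m) = u * u ^ (n - Suc m)" using that
      by (metis Suc_diff_Suc power_Suc)
    moreover have "Suc m choose 2 = m + (m choose 2)" by (simp add: numeral_2_eq_2 One_nat_def)
    ultimately show ?thesis by (simp add: power_add algebra_simps)
  qed
  have last: "?T (Suc n) (Suc n) = ?T n n * (v * p ^ n)"
  proof -
    have "Suc n choose 2 = n + (n choose 2)" by (simp add: numeral_2_eq_2 One_nat_def)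
    then show ?thesis by (simp add: qbin_eq_0 power_add algebra_simps)
  qed
  have "(\<Sum>m\<le>Suc n. ?T (Suc n) m) = ?T (Suc n) 0 + (\<Sum>m<n. ?T (Suc n) (Suc m)) + ?T (Suc n) (Suc n)"
    by (subst sum.atMost_Suc_shift) (simp only: lessThan_Suc_atMost[symmetric] sum.lessThan_Suc add.assoc)
  also have "\<dots> = ?T n 0 * u + (\<Sum>m<n. ?T n (Suc m) * u) + ((\<Sum>m<n. ?T n m * (v * p ^ n)) + ?T n n * (v * p ^ n))"
    using split last by (simp add: sum.distrib)
  also have "?T n 0 * u + (\<Sum>m<n. ?T n (Suc m) * u) = (\<Sum>m\<le>n. ?T n m * u)"
    by (subst sum.atMost_shift) (simp add: numeral_2_eq_2)
  also have "(\<Sum>m<n. ?T n m * (v * p ^ n)) + ?T n n * (v * p ^ n) = (\<Sum>m\<le>n. ?T n m * (v * p ^ n))"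
    by (simp flip: lessThan_Suc_atMost)
  also have "(\<Sum>m\<le>n. ?T n m * u) + (\<Sum>m\<le>n. ?T n m * (v * p ^ n)) = (\<Sum>m\<le>n. ?T n m) * (u + v * p ^ n)"
    by (simp add: sum_distrib_right distrib_left)
  finally show ?case using Suc by (simp del: sum.atMost_Suc)
qed (simp add: binomial_eq_0)

lemma prod_lessThan_add: "(\<Prod>i<m + n. f i) = (\<Prod>i<m. f i) * (\<Prod>i<n. f (i + m))"
  for f :: "nat \<Rightarrow> 'a::comm_monoid_mult"
  by (induction n) (simp_all add: mult_ac add.commute)

text \<open>Rothe's theorem with \<open>2 N\<close> factors, \<open>p = q ^ (a + b)\<close>, \<open>u = p ^ N\<close> and \<open>v = q ^ a\<close>. The upper half of
the factors gives the terms with \<open>a\<close> and, read backwards, the lower half gives those with \<open>b\<close>.\<close>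

lemma finite_triple_product:
  assumes "a \<ge> 1" "b \<ge> 1"
  shows "(\<Prod>i<N. (1 + fps_X ^ ((a + b) * i + a)) * (1 + fps_X ^ ((a + b) * i + b))) =
    (\<Sum>m\<le>2 * N. qbin (fps_X ^ (a + b)) (2 * N) m * fps_X ^ nat (theta_exp a b (int m - int N)) :: complex fps)"
proof -
  define k where "k = a + b"
  \<comment> \<open>The power of q that is common to all terms of the expanded product.\<close>
  define S where "S = k * N * N + a * N + k * (N choose 2)"
  let ?X = "fps_X :: complex fps"
  have c2: "2 * int (m choose 2) = int m * (int m - 1)" for m
  proof -
    have "even (m * (m - 1))" by (cases m) simp_all
    then have "2 * (m choose 2) = m * (m - 1)" by (simp only: choose_two dvd_mult_div_cancel)
    then have "int (2 * (m choose 2)) = int (m * (m - 1))" by simp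
    then show ?thesis by (cases m) (auto simp: algebra_simps)
  qed
  have expo: "k * N * (2 * N - m) + a * m + k * (m choose 2) = S + nat (theta_exp a b (int m - int N))"
    if "m \<le> 2 * N" for m
  proof -
    have nn: "0 \<le> theta_exp a b (int m - int N)"
      using abs_le_theta_exp[OF assms, of "int m - int N"] by linarith
    have "2 * (int k * N * (2 * int N - int m) + int a * m + int k * int (m choose 2)) =
      2 * (int k * N * (2 * int N - int m)) + 2 * (int a * m) + int k * (2 * int (m choose 2))"
      by (simp add: algebra_simps)
    also have "\<dots> = 2 * (int k * N * (2 * int N - int m)) + 2 * (int a * m) + int k * (int m * (int m - 1))"
      unfolding c2 ..
    also have "\<dots> = 2 * (int k * N * N) + 2 * (int a * N) + int k * (int N * (int N - 1))
       + 2 * theta_exp a b (int m - int N)"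
      unfolding two_theta_exp k_def by (simp add: algebra_simps)
    also have "\<dots> = 2 * (int S + theta_exp a b (int m - int N))"
      unfolding S_def c2[symmetric] by (simp add: algebra_simps)
    finally have "int (k * N * (2 * N - m) + a * m + k * (m choose 2)) = int S + theta_exp a b (int m - int N)"
      using that by (simp add: of_nat_diff)
    with nn show ?thesis by linarith
  qed
  have "(\<Prod>i<2 * N. ?X ^ (k * N) + ?X ^ a * (?X ^ k) ^ i) =
    (\<Sum>m\<le>2 * N. ?X ^ S * (qbin (?X ^ k) (2 * N) m * ?X ^ nat (theta_exp a b (int m - int N))))"
    unfolding rothe
  proof (rule sum.cong)
    fix m assume "m \<in> {..2 * N}"
    then have "?X ^ S * ?X ^ nat (theta_exp a b (int m - int N)) = ?X ^ (k * N * (2 * N - m) + a * m + k * (m choose 2))"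
      using expo[of m] by (simp add: power_add)
    then show "qbin (?X ^ k) (2 * N) m * (?X ^ (k * N)) ^ (2 * N - m) * (?X ^ a) ^ m * (?X ^ k) ^ (m choose 2) =
      ?X ^ S * (qbin (?X ^ k) (2 * N) m * ?X ^ nat (theta_exp a b (int m - int N)))"
      by (simp add: power_add power_mult mult_ac)
  qed simp
  moreover have "(\<Prod>i<2 * N. ?X ^ (k * N) + ?X ^ a * (?X ^ k) ^ i) =
    ?X ^ S * (\<Prod>i<N. (1 + ?X ^ (k * i + a)) * (1 + ?X ^ (k * i + b)))"
  proof -
    have "(\<Prod>i<2 * N. ?X ^ (k * N) + ?X ^ a * (?X ^ k) ^ i) =
      (\<Prod>i<N. ?X ^ (k * N) + ?X ^ a * (?X ^ k) ^ i) * (\<Prod>i<N. ?X ^ (k * N) + ?X ^ a * (?X ^ k) ^ (i + N))"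
      unfolding mult_2 by (rule prod_lessThan_add)
    also have "(\<Prod>i<N. ?X ^ (k * N) + ?X ^ a * (?X ^ k) ^ (i + N)) = (\<Prod>i<N. ?X ^ (k * N) * (1 + ?X ^ (k * i + a)))"
    proof (rule prod.cong)
      fix i
      have "?X ^ a * (?X ^ k) ^ (i + N) = ?X ^ (k * N) * ?X ^ (k * i + a)"
        by (simp add: algebra_simps flip: power_mult power_add)
      then show "?X ^ (k * N) + ?X ^ a * (?X ^ k) ^ (i + N) = ?X ^ (k * N) * (1 + ?X ^ (k * i + a))"
        by (simp only: distrib_left mult_1_right)
    qed simp
    also have "\<dots> = ?X ^ (k * N * N) * (\<Prod>i<N. 1 + ?X ^ (k * i + a))"
      by (simp add: prod.distrib power_mult)
    also have "(\<Prod>i<N. ?X ^ (k * N) + ?X ^ a * (?X ^ k) ^ i) = (\<Prod>i<N. ?X ^ (a + k * i) * (1 + ?X ^ (k * (N - Suc i) + b)))"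
    proof (rule prod.cong)
      fix i assume "i \<in> {..<N}"
      then obtain d where "N = Suc (i + d)" using less_imp_Suc_add by auto
      then have "k * N = a + k * i + (k * (N - Suc i) + b)" by (simp add: k_def algebra_simps)
      then have "?X ^ (k * N) = ?X ^ (a + k * i) * ?X ^ (k * (N - Suc i) + b)" by (simp only: power_add)
      moreover have "?X ^ a * (?X ^ k) ^ i = ?X ^ (a + k * i)" by (simp only: power_add power_mult)
      ultimately show "?X ^ (k * N) + ?X ^ a * (?X ^ k) ^ i = ?X ^ (a + k * i) * (1 + ?X ^ (k * (N - Suc i) + b))"
        by (simp only: distrib_left mult_1_right add.commute)
    qed simp
    also have "\<dots> = ?X ^ (a * N + k * (N choose 2)) * (\<Prod>i<N. 1 + ?X ^ (k * (N - Suc i) + b))"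
    proof -
      have "(\<Prod>i<N. ?X ^ (a + k * i)) = ?X ^ (a * N + k * (N choose 2))"
      proof (induction N)
        case (Suc N)
        have "Suc N choose 2 = N + (N choose 2)" by (simp add: numeral_2_eq_2 One_nat_def)
        with Suc show ?case by (simp add: power_add algebra_simps)
      qed (simp add: choose_two)
      then show ?thesis by (simp add: prod.distrib)
    qed
    also have "(\<Prod>i<N. 1 + ?X ^ (k * (N - Suc i) + b)) = (\<Prod>i<N. 1 + ?X ^ (k * i + b))"
      by (rule prod.nat_diff_reindex)
    finally show ?thesis by (simp add: S_def prod.distrib power_add mult_ac)
  qed
  ultimately have "?X ^ S * (\<Prod>i<N. (1 + ?X ^ (k * i + a)) * (1 + ?X ^ (k * i + b))) =
    ?X ^ S * (\<Sum>m\<le>2 * N. qbin (?X ^ k) (2 * N) m * ?X ^ nat (theta_exp a b (int m - int N)))"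
    by (simp add: sum_distrib_left)
  then show ?thesis by (simp add: k_def)
qed

text \<open>In the middle of a long row, the Gaussian binomial coefficients are close to the inverse of the
infinite product.\<close>

lemma qbin_agree:
  assumes "k \<ge> 1" "K \<le> m" "K \<le> n - m" "m \<le> n" "K \<le> N"
  shows "agree K (qpoch (fps_X ^ k) N * qbin (fps_X ^ k) n m) 1"
proof -
  let ?P = "qpoch (fps_X ^ k :: complex fps)"
  have q: "qbin (fps_X ^ k) n m * ?P m * ?P (n - m) = ?P n"
    using assms by (intro qbin_qpoch) simp
  have e: "agree K (?P M) (euler_f k)" if "K \<le> M" for M
    using qpoch_agree[OF assms(1) that] .
  have r: "agree K F F" for F by (simp add: agree_def)
  have t: "agree K F H" if "agree K F G" "agree K G H" for F G H using that by (simp add: agree_def)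
  have s: "agree K G F" if "agree K F G" for F G using that by (simp add: agree_def)
  have "agree K (euler_f k * (?P N * qbin (fps_X ^ k) n m)) (?P m * (?P (n - m) * qbin (fps_X ^ k) n m))"
    using assms by (intro agree_mult r; blast intro: s e t)
  also have "?P m * (?P (n - m) * qbin (fps_X ^ k) n m) = ?P n"
    using q by (simp add: mult_ac)
  finally have "agree K (euler_f k * (?P N * qbin (fps_X ^ k) n m)) (euler_f k * 1)"
    using t e[of n] assms by simp
  then show ?thesis
    by (rule agree_cancel) (simp add: euler_f_has_prod(2)[OF assms(1)])
qed

text \<open>The coefficient of \<open>q ^ K\<close> only sees the indices of absolute value at most \<open>K\<close>. For \<open>N\<close> at least
\<open>2 K\<close> these lie so far inside the row that their Gaussian binomial coefficients, multiplied by
\<open>(p; p)\<^sub>N\<close>, agree with 1 up to that order.\<close>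

lemma jacobi_triple_product:
  assumes "a \<ge> 1" "b \<ge> 1"
  shows "(\<lambda>N. (\<Prod>i<N. (1 + fps_X ^ ((a + b) * i + a)) * (1 + fps_X ^ ((a + b) * i + b))) * qpoch (fps_X ^ (a + b)) N)
    \<longlonglongrightarrow> ramanujan_f a b"
proof (rule tendsto_fpsI)
  fix K
  let ?X = "fps_X :: complex fps"
  let ?Q = "\<lambda>N m. theta_exp a b (int m - int N)"
  have "((\<Prod>i<N. (1 + ?X ^ ((a + b) * i + a)) * (1 + ?X ^ ((a + b) * i + b))) * qpoch (?X ^ (a + b)) N) $ K
      = ramanujan_f a b $ K" if "N \<ge> 2 * K" for N
  proof -
    have "((\<Prod>i<N. (1 + ?X ^ ((a + b) * i + a)) * (1 + ?X ^ ((a + b) * i + b))) * qpoch (?X ^ (a + b)) N) $ K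
      = (\<Sum>m\<le>2 * N. (?X ^ nat (?Q N m) * (qpoch (?X ^ (a + b)) N * qbin (?X ^ (a + b)) (2 * N) m)) $ K)"
      unfolding finite_triple_product[OF assms] sum_distrib_right fps_sum_nth
      by (rule sum.cong) (simp_all add: mult_ac)
    also have "\<dots> = (\<Sum>m\<le>2 * N. if ?Q N m = int K then 1 else 0)"
    proof (rule sum.cong)
      fix m assume m: "m \<in> {..2 * N}"
      have le: "\<bar>int m - int N\<bar> \<le> ?Q N m" by (rule abs_le_theta_exp[OF assms])
      show "(?X ^ nat (?Q N m) * (qpoch (?X ^ (a + b)) N * qbin (?X ^ (a + b)) (2 * N) m)) $ K =
         (if ?Q N m = int K then 1 else 0)"
      proof (cases "K < nat (?Q N m)")
        case True
        then show ?thesis by (simp add: fps_X_power_mult_nth)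
      next
        case False
        with le have "\<bar>int m - int N\<bar> \<le> int K" by linarith
        with that m have "agree K (qpoch (?X ^ (a + b)) N * qbin (?X ^ (a + b)) (2 * N) m) 1"
          by (intro qbin_agree) (use assms in auto)
        then have "(qpoch (?X ^ (a + b)) N * qbin (?X ^ (a + b)) (2 * N) m) $ (K - nat (?Q N m)) = 1 $ (K - nat (?Q N m))"
          unfolding agree_def by simp
        with False le show ?thesis by (auto simp: fps_X_power_mult_nth)
      qed
    qed simp
    also have "\<dots> = of_nat (card {m \<in> {..2 * N}. ?Q N m = int K})"
      by (simp add: sum.If_cases Int_def)
    also have "card {m \<in> {..2 * N}. ?Q N m = int K} = card {j. theta_exp a b j = int K}"
    proof (rule bij_betw_same_card)
      show "bij_betw (\<lambda>m. int m - int N) {m \<in> {..2 * N}. ?Q N m = int K} {j. theta_exp a b j = int K}"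
      proof (rule bij_betw_byWitness[where f' = "\<lambda>j. nat (j + int N)"])
        have "\<bar>j\<bar> \<le> int N" if "theta_exp a b j = int K" for j
          using abs_le_theta_exp[OF assms, of j] that \<open>N \<ge> 2 * K\<close> by linarith
        then show "(\<lambda>j. nat (j + int N)) ` {j. theta_exp a b j = int K} \<subseteq> {m \<in> {..2 * N}. ?Q N m = int K}"
          "\<forall>j\<in>{j. theta_exp a b j = int K}. int (nat (j + int N)) - int N = j"
          by (force simp: abs_le_iff)+
      qed auto
    qed
    finally show ?thesis by (simp add: ramanujan_f_def theta_nth)
  qed
  then show "\<forall>\<^sub>F N in sequentially. ((\<Prod>i<N. (1 + ?X ^ ((a + b) * i + a)) * (1 + ?X ^ ((a + b) * i + b))) * qpoch (?X ^ (a + b)) N) $ K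
      = ramanujan_f a b $ K"
    unfolding eventually_sequentially by blast
qed

section \<open>Product formulas\<close>

lemma power_power_eq: "a * m = b * n \<Longrightarrow> (q ^ a) ^ m = (q ^ b) ^ n" for q :: "'a::comm_ring_1"
  by (metis power_mult)

lemma one_minus_square: "m = 2 * n \<Longrightarrow> 1 - q ^ m = (1 + q ^ n) * (1 - q ^ n)" for q :: "'a::comm_ring_1"
proof -
  assume "m = 2 * n"
  then have "q ^ m = q ^ n * q ^ n" by (simp add: mult_2 power_add)
  then show ?thesis by (simp add: algebra_simps)
qed

text \<open>The identity \<open>\<psi>(q) = f\<^sub>2\<^sup>2 / f\<^sub>1\<close>. All factors \<open>1 + q ^ i\<close> of the triple product have odd \<open>i\<close>, and
multiplying by \<open>1 - q ^ i\<close> turns them into \<open>1 - q ^ (2 i)\<close>. The factor \<open>f\<^sub>4\<close> is inserted on both sides so that the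
finite identity holds exactly at every length.\<close>

lemma ramanujan_f_1_3_euler_f: "ramanujan_f 1 3 * euler_f 1 = euler_f 2 ^ 2"
proof -
  let ?X = "fps_X :: complex fps"
  let ?T = "\<lambda>N. (\<Prod>i<N. (1 + ?X ^ (4 * i + 1)) * (1 + ?X ^ (4 * i + 3))) * qpoch (?X ^ 4) N"
  have fin: "?T N * qpoch (?X ^ 1) (4 * N) * qpoch (?X ^ 4) (2 * N) =
    qpoch (?X ^ 2) (4 * N) * qpoch (?X ^ 2) (2 * N) * qpoch (?X ^ 4) N" for N
  proof (induction N)
    case (Suc N)
    let ?x = "?X ^ (4 * N + 1)" and ?y = "?X ^ (4 * N + 3)"
    let ?S = "(1 + ?x) * (1 - ?x) * (1 + ?y) * (1 - ?y) * (1 - ?X ^ (4 * N + 2)) * (1 - ?X ^ (4 * N + 4))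
      * (1 - ?X ^ (8 * N + 4)) * (1 - ?X ^ (8 * N + 8)) * (1 - ?X ^ (4 * N + 4))"
    have e: "4 * Suc N = Suc (Suc (Suc (Suc (4 * N))))" "2 * Suc N = Suc (Suc (2 * N))" by simp_all
    have n: "1 * Suc (4 * N) = 4 * N + 1" "1 * Suc (Suc (4 * N)) = 4 * N + 2"
        "1 * Suc (Suc (Suc (4 * N))) = 4 * N + 3" "1 * Suc (Suc (Suc (Suc (4 * N)))) = 4 * N + 4"
        "4 * Suc (2 * N) = 8 * N + 4" "4 * Suc (Suc (2 * N)) = 8 * N + 8" "4 * Suc N = 4 * N + 4"
        "2 * Suc (4 * N) = 8 * N + 2" "2 * Suc (Suc (4 * N)) = 8 * N + 4"
        "2 * Suc (Suc (Suc (4 * N))) = 8 * N + 6" "2 * Suc (Suc (Suc (Suc (4 * N)))) = 8 * N + 8"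
        "2 * Suc (2 * N) = 4 * N + 2" "2 * Suc (Suc (2 * N)) = 4 * N + 4" by simp_all
    have sq: "1 - ?X ^ (8 * N + 2) = (1 + ?x) * (1 - ?x)" "1 - ?X ^ (8 * N + 6) = (1 + ?y) * (1 - ?y)"
      by (rule one_minus_square, simp)+
    have "?T (Suc N) * qpoch (?X ^ 1) (4 * Suc N) * qpoch (?X ^ 4) (2 * Suc N) =
      (?T N * qpoch (?X ^ 1) (4 * N) * qpoch (?X ^ 4) (2 * N)) * ?S"
      unfolding e qpoch_Suc prod.lessThan_Suc unfolding power_mult[symmetric] n by (simp only: mult_ac)
    also have "\<dots> = qpoch (?X ^ 2) (4 * N) * qpoch (?X ^ 2) (2 * N) * qpoch (?X ^ 4) N * ?S"
      unfolding Suc ..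
    also have "\<dots> = qpoch (?X ^ 2) (4 * Suc N) * qpoch (?X ^ 2) (2 * Suc N) * qpoch (?X ^ 4) (Suc N)"
      unfolding e qpoch_Suc unfolding power_mult[symmetric] n sq by (simp only: mult_ac)
    finally show ?case .
  qed simp
  have "(\<lambda>N. ?T N * qpoch (?X ^ 1) (4 * N) * qpoch (?X ^ 4) (2 * N))
      \<longlonglongrightarrow> ramanujan_f 1 3 * euler_f 1 * euler_f 4"
    by (intro tendsto_mult_fps tendsto_euler_f_mult)
      (use jacobi_triple_product[of 1 3] in \<open>simp_all\<close>)
  moreover have "(\<lambda>N. qpoch (?X ^ 2) (4 * N) * qpoch (?X ^ 2) (2 * N) * qpoch (?X ^ 4) N)
      \<longlonglongrightarrow> euler_f 2 * euler_f 2 * euler_f 4"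
    by (intro tendsto_mult_fps tendsto_euler_f_mult tendsto_euler_f) simp_all
  ultimately have "ramanujan_f 1 3 * euler_f 1 * euler_f 4 = euler_f 2 * euler_f 2 * euler_f 4"
    unfolding fin by (rule LIMSEQ_unique)
  moreover have "euler_f 4 \<noteq> 0" using euler_f_has_prod(2)[of 4] by auto
  ultimately show ?thesis by (simp add: power2_eq_square)
qed

text \<open>Here the factors \<open>1 + q ^ i\<close> are those with \<open>i\<close> prime to 3.\<close>

lemma ramanujan_f_1_2_euler_f: "ramanujan_f 1 2 * euler_f 1 * euler_f 6 = euler_f 2 * euler_f 3 ^ 2"
proof -
  let ?X = "fps_X :: complex fps"
  let ?T = "\<lambda>N. (\<Prod>i<N. (1 + ?X ^ (3 * i + 1)) * (1 + ?X ^ (3 * i + 2))) * qpoch (?X ^ 3) N"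
  have fin: "?T N * qpoch (?X ^ 1) (3 * N) * qpoch (?X ^ 6) N =
    qpoch (?X ^ 2) (3 * N) * (qpoch (?X ^ 3) N * qpoch (?X ^ 3) N)" for N
  proof (induction N)
    case (Suc N)
    let ?x = "?X ^ (3 * N + 1)" and ?y = "?X ^ (3 * N + 2)"
    let ?S = "(1 + ?x) * (1 - ?x) * (1 + ?y) * (1 - ?y) * (1 - ?X ^ (3 * N + 3)) * (1 - ?X ^ (3 * N + 3))
      * (1 - ?X ^ (6 * N + 6))"
    have e: "3 * Suc N = Suc (Suc (Suc (3 * N)))" by simp
    have n: "1 * Suc (3 * N) = 3 * N + 1" "1 * Suc (Suc (3 * N)) = 3 * N + 2"
        "1 * Suc (Suc (Suc (3 * N))) = 3 * N + 3"
        "6 * Suc N = 6 * N + 6" "3 * Suc N = 3 * N + 3"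
        "2 * Suc (3 * N) = 6 * N + 2" "2 * Suc (Suc (3 * N)) = 6 * N + 4"
        "2 * Suc (Suc (Suc (3 * N))) = 6 * N + 6" by simp_all
    have sq: "1 - ?X ^ (6 * N + 2) = (1 + ?x) * (1 - ?x)" "1 - ?X ^ (6 * N + 4) = (1 + ?y) * (1 - ?y)"
      by (rule one_minus_square, simp)+
    have "?T (Suc N) * qpoch (?X ^ 1) (3 * Suc N) * qpoch (?X ^ 6) (Suc N) =
      (?T N * qpoch (?X ^ 1) (3 * N) * qpoch (?X ^ 6) N) * ?S"
      unfolding e qpoch_Suc prod.lessThan_Suc unfolding power_mult[symmetric] n by (simp only: mult_ac)
    also have "\<dots> = qpoch (?X ^ 2) (3 * N) * (qpoch (?X ^ 3) N * qpoch (?X ^ 3) N) * ?S"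
      unfolding Suc ..
    also have "\<dots> = qpoch (?X ^ 2) (3 * Suc N) * (qpoch (?X ^ 3) (Suc N) * qpoch (?X ^ 3) (Suc N))"
      unfolding e qpoch_Suc unfolding power_mult[symmetric] n sq by (simp only: mult_ac)
    finally show ?case .
  qed simp
  have "(\<lambda>N. ?T N * qpoch (?X ^ 1) (3 * N) * qpoch (?X ^ 6) N)
      \<longlonglongrightarrow> ramanujan_f 1 2 * euler_f 1 * euler_f 6"
    by (intro tendsto_mult_fps tendsto_euler_f_mult tendsto_euler_f)
      (use jacobi_triple_product[of 1 2] in \<open>simp_all\<close>)
  moreover have "(\<lambda>N. qpoch (?X ^ 2) (3 * N) * (qpoch (?X ^ 3) N * qpoch (?X ^ 3) N))
      \<longlonglongrightarrow> euler_f 2 * (euler_f 3 * euler_f 3)"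
    by (intro tendsto_mult_fps tendsto_euler_f_mult tendsto_euler_f) simp_all
  ultimately show ?thesis
    unfolding fin power2_eq_square by (rule LIMSEQ_unique)
qed

section \<open>Multiplication over the cube roots of unity\<close>

abbreviation twist :: "complex \<Rightarrow> complex fps \<Rightarrow> complex fps" where
  "twist w F \<equiv> fps_compose F (fps_const w * fps_X)"

lemma twist_rules:
  "twist w (F + G) = twist w F + twist w G" "twist w (F - G) = twist w F - twist w G"
  "twist w (F * G) = twist w F * twist w G" "twist w (F ^ k) = twist w F ^ k"
  "twist w fps_X = fps_const w * fps_X" "twist w 1 = 1"
  by (simp_all add: fps_compose_add_distrib fps_compose_sub_distrib
      fps_compose_mult_distrib fps_compose_power)

lemma twist_dilate:
  assumes "m > 0"
  shows "twist w (dilate m F) = dilate m (twist (w ^ m) F)"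
proof (rule fps_ext)
  fix n show "twist w (dilate m F) $ n = dilate m (twist (w ^ m) F) $ n"
    using assms by (auto simp: dilate_nth fps_nth_compose_linear simp flip: power_mult)
qed

lemma twist_1: "twist 1 F = F"
  by (rule fps_ext) (simp add: fps_nth_compose_linear)

lemma twist_dilate_3:
  assumes "w ^ 3 = 1"
  shows "twist w (dilate 3 F) = dilate 3 F"
  using assms by (simp add: twist_dilate twist_1)

text \<open>The three conjugates of \<open>1 - q ^ i\<close> multiply to \<open>1 - q ^ (3 i)\<close> if 3 does not divide \<open>i\<close>, and to
\<open>(1 - q ^ i) ^ 3\<close> if it does.\<close>

lemma euler_f_cube_roots:
  assumes w: "w ^ 2 + w + 1 = 0"
  shows "euler_f 1 * twist w (euler_f 1) * twist (w ^ 2) (euler_f 1) * euler_f 9 = euler_f 3 ^ 4"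
proof -
  let ?X = "fps_X :: complex fps"
  let ?P = "qpoch (?X ^ 1)"
  have w3: "w ^ 3 = 1"
  proof -
    have "w ^ 3 - 1 = (w - 1) * (w ^ 2 + w + 1)" by (simp add: algebra_simps power2_eq_square power3_eq_cube)
    then show ?thesis using w by simp
  qed
  have rot: "twist v (qpoch (?X ^ 1) n) = (\<Prod>i<n. 1 - fps_const (v ^ Suc i) * ?X ^ Suc i)" for v n
  proof (induction n)
    case (Suc n)
    have "twist v (?X ^ Suc n) = fps_const (v ^ Suc n) * ?X ^ Suc n"
      by (subst twist_rules, subst twist_rules, subst power_mult_distrib, subst fps_const_power) (rule refl)
    then show ?case using Suc by (simp add: qpoch_Suc twist_rules(2,3,6) del: power_Suc)
  qed (simp add: twist_rules)
  have cube: "(1 - y) * (1 - fps_const w * y) * (1 - fps_const (w ^ 2) * y) = 1 - y ^ 3" for y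
  proof -
    have "(1 - y) * (1 - fps_const w * y) * (1 - fps_const (w ^ 2) * y) =
      1 - fps_const (w ^ 2 + w + 1) * y + fps_const (w * (w ^ 2 + w + 1)) * y ^ 2 - fps_const (w ^ 3) * y ^ 3"
      by (simp add: algebra_simps power2_eq_square power3_eq_cube flip: fps_const_mult fps_const_add)
    then show ?thesis using w w3 by simp
  qed
  have fin: "?P (3 * N) * twist w (?P (3 * N)) * twist (w ^ 2) (?P (3 * N)) * qpoch (?X ^ 9) N =
    qpoch (?X ^ 3) (3 * N) * (qpoch (?X ^ 3) N * qpoch (?X ^ 3) N * qpoch (?X ^ 3) N)" for N
  proof (induction N)
    case (Suc N)
    let ?c = "\<lambda>n. (1 - ?X ^ n) * (1 - fps_const (w ^ n) * ?X ^ n) * (1 - fps_const ((w ^ 2) ^ n) * ?X ^ n)"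
    have c0: "?c (3 * N + 3) = (1 - ?X ^ (3 * N + 3)) ^ 3"
    proof -
      have "w ^ (3 * N + 3) = 1" using w3 by (simp add: power_add power_mult)
      moreover have "(w ^ 2) ^ (3 * N + 3) = (w ^ (3 * N + 3)) ^ 2" by (rule power_power_eq) simp
      ultimately show ?thesis by (simp add: power3_eq_cube)
    qed
    have c1: "?c (3 * N + 1) = 1 - ?X ^ (9 * N + 3)"
    proof -
      have "w ^ (3 * N + 1) = w" using w3 by (simp add: power_add power_mult)
      moreover have "(w ^ 2) ^ (3 * N + 1) = (w ^ (3 * N + 1)) ^ 2" by (rule power_power_eq) simp
      moreover have "(?X ^ (3 * N + 1)) ^ 3 = ?X ^ (9 * N + 3)" by (subst power_mult[symmetric], rule arg_cong[where f = "\<lambda>n. ?X ^ n"]) simp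
      ultimately show ?thesis using cube[of "?X ^ (3 * N + 1)"] by simp
    qed
    have c2: "?c (3 * N + 2) = 1 - ?X ^ (9 * N + 6)"
    proof -
      have w2: "w ^ (3 * N + 2) = w ^ 2" by (simp only: power_add power_mult w3 power_one mult_1_left)
      have "(w ^ 2) ^ (3 * N + 2) = (w ^ (3 * N + 2)) ^ 2" by (rule power_power_eq) simp
      also have "\<dots> = w ^ 3 * w" unfolding w2 by (simp add: power2_eq_square power3_eq_cube)
      finally have w4: "(w ^ 2) ^ (3 * N + 2) = w" using w3 by simp
      have "(?X ^ (3 * N + 2)) ^ 3 = ?X ^ (9 * N + 6)" by (subst power_mult[symmetric], rule arg_cong[where f = "\<lambda>n. ?X ^ n"]) simp
      then show ?thesis using cube[of "?X ^ (3 * N + 2)"] unfolding w2 w4 by (simp only: mult_ac)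
    qed
    have e: "3 * Suc N = Suc (Suc (Suc (3 * N)))" by simp
    have n: "1 * Suc (3 * N) = 3 * N + 1" "1 * Suc (Suc (3 * N)) = 3 * N + 2"
        "1 * Suc (Suc (Suc (3 * N))) = 3 * N + 3" "Suc (3 * N) = 3 * N + 1" "Suc (3 * N + 1) = 3 * N + 2" "Suc (3 * N + 2) = 3 * N + 3"
        "9 * Suc N = 9 * N + 9" "3 * Suc N = 3 * N + 3"
        "3 * (3 * N + 1) = 9 * N + 3" "3 * (3 * N + 2) = 9 * N + 6"
        "3 * (3 * N + 3) = 9 * N + 9" by simp_all
    have P: "?P (3 * Suc N) = ?P (3 * N) * (1 - ?X ^ (3 * N + 1)) * (1 - ?X ^ (3 * N + 2)) * (1 - ?X ^ (3 * N + 3))"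
      unfolding e qpoch_Suc unfolding power_mult[of ?X, symmetric] n by (simp only: mult_ac mult_1_left)
    have R: "twist v (?P (3 * Suc N)) = twist v (?P (3 * N)) * (1 - fps_const (v ^ (3 * N + 1)) * ?X ^ (3 * N + 1))
       * (1 - fps_const (v ^ (3 * N + 2)) * ?X ^ (3 * N + 2)) * (1 - fps_const (v ^ (3 * N + 3)) * ?X ^ (3 * N + 3))" for v
      unfolding rot e prod.lessThan_Suc unfolding n by (simp only: mult_ac)
    have Q: "qpoch (?X ^ 9) (Suc N) = qpoch (?X ^ 9) N * (1 - ?X ^ (9 * N + 9))"
      unfolding qpoch_Suc power_mult[of ?X, symmetric] n ..
    have "?P (3 * Suc N) * twist w (?P (3 * Suc N)) * twist (w ^ 2) (?P (3 * Suc N)) * qpoch (?X ^ 9) (Suc N) =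
      (?P (3 * N) * twist w (?P (3 * N)) * twist (w ^ 2) (?P (3 * N)) * qpoch (?X ^ 9) N) *
      (?c (3 * N + 1) * ?c (3 * N + 2) * ?c (3 * N + 3) * (1 - ?X ^ (9 * N + 9)))"
      unfolding R Q unfolding P by (simp only: mult_ac)
    also have "\<dots> = qpoch (?X ^ 3) (3 * N) * (qpoch (?X ^ 3) N * qpoch (?X ^ 3) N * qpoch (?X ^ 3) N) *
       ((1 - ?X ^ (9 * N + 3)) * (1 - ?X ^ (9 * N + 6)) * (1 - ?X ^ (3 * N + 3)) ^ 3 * (1 - ?X ^ (9 * N + 9)))"
      unfolding Suc c0 c1 c2 ..
    also have "\<dots> = qpoch (?X ^ 3) (3 * Suc N) * (qpoch (?X ^ 3) (Suc N) * qpoch (?X ^ 3) (Suc N) * qpoch (?X ^ 3) (Suc N))"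
      unfolding e qpoch_Suc unfolding power_mult[of ?X, symmetric] n power3_eq_cube[of "1 - ?X ^ (3 * N + 3)"] by (simp only: mult_ac)
    finally show ?case .
  qed (simp add: twist_rules)
  have lim_rot: "(\<lambda>N. twist v (?P (3 * N))) \<longlonglongrightarrow> twist v (euler_f 1)" for v
  proof (rule tendsto_fpsI)
    fix n
    have "\<forall>\<^sub>F N in sequentially. ?P (3 * N) $ n = euler_f 1 $ n"
      using tendsto_euler_f_mult[of 1 3] by (simp add: tendsto_fps_iff)
    then show "\<forall>\<^sub>F N in sequentially. twist v (?P (3 * N)) $ n = twist v (euler_f 1) $ n"
      by eventually_elim (simp add: fps_nth_compose_linear)
  qed
  have "(\<lambda>N. ?P (3 * N) * twist w (?P (3 * N)) * twist (w ^ 2) (?P (3 * N)) * qpoch (?X ^ 9) N)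
     \<longlonglongrightarrow> euler_f 1 * twist w (euler_f 1) * twist (w ^ 2) (euler_f 1) * euler_f 9"
    by (intro tendsto_mult_fps tendsto_euler_f_mult tendsto_euler_f lim_rot) simp_all
  moreover have "(\<lambda>N. qpoch (?X ^ 3) (3 * N) * (qpoch (?X ^ 3) N * qpoch (?X ^ 3) N * qpoch (?X ^ 3) N))
     \<longlonglongrightarrow> euler_f 3 * (euler_f 3 * euler_f 3 * euler_f 3)"
    by (intro tendsto_mult_fps tendsto_euler_f_mult tendsto_euler_f) simp_all
  ultimately have "euler_f 1 * twist w (euler_f 1) * twist (w ^ 2) (euler_f 1) * euler_f 9
     = euler_f 3 * (euler_f 3 * euler_f 3 * euler_f 3)"
    unfolding fin by (rule LIMSEQ_unique)
  then show ?thesis by (simp add: power4_eq_xxxx mult.assoc)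
qed

lemma dilate_inject:
  assumes "m > 0" "dilate m F = dilate m G"
  shows "F = G"
proof (rule fps_ext)
  fix n
  have "dilate m F $ (m * n) = dilate m G $ (m * n)" using assms(2) by simp
  then show "F $ n = G $ n" using assms(1) by (simp add: dilate_nth)
qed

text \<open>Writing \<open>\<psi>(q) = a + q b\<close> with \<open>a\<close> and \<open>b\<close> series in \<open>q\<^sup>3\<close>, the product of the three conjugates of
\<open>\<psi>(q)\<close> is \<open>a\<^sup>3 + q\<^sup>3 b\<^sup>3\<close>, while the product formula for \<open>\<psi>\<close> evaluates it in terms of \<open>f\<^sub>m\<close>. Replacing
\<open>q\<^sup>3\<close> by \<open>q\<close> and reading the result as \<open>\<psi>(q)\<^sup>4 / \<psi>(q\<^sup>3)\<close> gives the claim.\<close>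

lemma cubic_psi: "dilate 3 psi * ramanujan_f 1 2 ^ 3 + fps_X * dilate 3 psi ^ 4 = psi ^ 4"
proof -
  define w :: complex where "w = Complex (- 1 / 2) (sqrt 3 / 2)"
  have w: "w ^ 2 + w + 1 = 0"
    by (simp add: w_def power2_eq_square complex_eq_iff)
  have w3: "w ^ 3 = 1" "(w ^ 2) ^ 3 = 1"
  proof -
    have "w ^ 3 - 1 = (w - 1) * (w ^ 2 + w + 1)" by (simp add: algebra_simps power2_eq_square power3_eq_cube)
    then show 1: "w ^ 3 = 1" using w by simp
    have "(w ^ 2) ^ 3 = (w ^ 3) ^ 2" by (rule power_power_eq) simp
    then show "(w ^ 2) ^ 3 = 1" using 1 by simp
  qed
  have w4: "(w ^ 2) ^ 2 = w"
  proof -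
    have "(w ^ 2) ^ 2 = w ^ 3 * w" by (simp add: power2_eq_square power3_eq_cube)
    then show ?thesis using w3 by simp
  qed
  let ?r = "twist w" and ?s = "twist (w ^ 2)"
  let ?e = "\<lambda>m. euler_f m" and ?A = "ramanujan_f 1 2" and ?B = "dilate 3 psi"
  let ?a = "dilate 3 ?A" and ?b = "dilate 3 ?B"
  have psi: "psi = ?a + fps_X * ?b"
    using psi_dissection by (simp add: dilate_dilate)
  have norm_psi: "psi * ?r psi * ?s psi = ?a ^ 3 + fps_X ^ 3 * ?b ^ 3"
  proof -
    have r: "twist v psi = ?a + fps_const v * fps_X * ?b" if "v ^ 3 = 1" for v
      by (subst psi) (simp add: twist_rules twist_dilate_3[OF that])
    have "(1::complex fps) + fps_const w + fps_const w ^ 2 = fps_const (w ^ 2 + w + 1)"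
      by (simp add: power2_eq_square add_ac flip: fps_const_add fps_const_mult)
    then have z: "1 + fps_const w + fps_const w ^ 2 = 0" using w by simp
    have "(a + x * b) * (a + z * x * b) * (a + z ^ 2 * x * b) = a ^ 3 + x ^ 3 * b ^ 3"
      if "1 + z + z ^ 2 = 0" for a b x z :: "complex fps"
      using that by algebra
    from this[OF z, of ?a fps_X ?b] show ?thesis
      unfolding r[OF w3(1)] r[OF w3(2)] psi[symmetric] by (simp add: fps_const_power)
  qed
  have norm1: "?e 1 * ?r (?e 1) * ?s (?e 1) * ?e 9 = ?e 3 ^ 4"
    by (rule euler_f_cube_roots[OF w])
  have norm2: "?e 2 * ?r (?e 2) * ?s (?e 2) * ?e 18 = ?e 6 ^ 4"
  proof -
    have e2: "?e 2 = dilate 2 (?e 1)" by (simp add: dilate_euler_f)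
    have r2: "?r (?e 2) = dilate 2 (?s (?e 1))" unfolding e2 by (rule twist_dilate) simp
    have s2: "?s (?e 2) = dilate 2 (?r (?e 1))"
      unfolding e2 using twist_dilate[where w = "w ^ 2" and m = 2 and F = "?e 1"] w4 by simp
    have "?e 2 * ?r (?e 2) * ?s (?e 2) * ?e 18 = dilate 2 (?e 1 * ?r (?e 1) * ?s (?e 1) * ?e 9)"
      unfolding r2 s2 by (simp add: dilate_rules dilate_euler_f mult_ac)
    then show ?thesis unfolding norm1 by (simp add: dilate_rules dilate_euler_f)
  qed
  have p: "psi * ?e 1 = ?e 2 ^ 2" using ramanujan_f_1_3_euler_f by (simp add: psi_def)
  have pr: "twist v psi * twist v (?e 1) = twist v (?e 2) ^ 2" for v
    using arg_cong[OF p, of "twist v"] by (simp add: twist_rules)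
  have "(psi * ?r psi * ?s psi) * (?e 1 * ?r (?e 1) * ?s (?e 1)) = (?e 2 * ?r (?e 2) * ?s (?e 2)) ^ 2"
    using p pr[of w] pr[of "w ^ 2"] by algebra
  then have "(?a ^ 3 + fps_X ^ 3 * ?b ^ 3) * ?e 3 ^ 4 * ?e 18 ^ 2 = (?e 6 ^ 4) ^ 2 * ?e 9"
    unfolding norm_psi using norm1 norm2 by algebra
  then have "dilate 3 ((?A ^ 3 + fps_X * ?B ^ 3) * ?e 1 ^ 4 * ?e 6 ^ 2) = dilate 3 ((?e 2 ^ 4) ^ 2 * ?e 3)"
    by (simp add: dilate_rules dilate_euler_f)
  then have *: "(?A ^ 3 + fps_X * ?B ^ 3) * ?e 1 ^ 4 * ?e 6 ^ 2 = (?e 2 ^ 4) ^ 2 * ?e 3"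
    by (metis dilate_inject zero_less_numeral)
  have B: "?B * ?e 3 = ?e 6 ^ 2"
    using arg_cong[OF p, of "dilate 3"] by (simp add: dilate_rules dilate_euler_f)
  have "(?B * ?A ^ 3 + fps_X * ?B ^ 4) * (?e 1 ^ 4 * ?e 3 * ?e 6 ^ 2) =
      (?B * ?e 3) * ((?A ^ 3 + fps_X * ?B ^ 3) * ?e 1 ^ 4 * ?e 6 ^ 2)"
    by algebra
  also have "\<dots> = (psi * ?e 1) ^ 4 * ?e 3 * ?e 6 ^ 2"
    unfolding * B p by algebra
  also have "\<dots> = psi ^ 4 * (?e 1 ^ 4 * ?e 3 * ?e 6 ^ 2)"
    by algebra
  finally have "(?B * ?A ^ 3 + fps_X * ?B ^ 4) * (?e 1 ^ 4 * ?e 3 * ?e 6 ^ 2) = psi ^ 4 * (?e 1 ^ 4 * ?e 3 * ?e 6 ^ 2)" .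
  moreover have "?e 1 ^ 4 * ?e 3 * ?e 6 ^ 2 \<noteq> 0"
    using euler_f_has_prod(2)[of 1] euler_f_has_prod(2)[of 3] euler_f_has_prod(2)[of 6] by auto
  ultimately show ?thesis by simp
qed

section \<open>Sections modulo 3\<close>

definition section3 :: "nat \<Rightarrow> complex fps \<Rightarrow> complex fps" where
  "section3 r F = Abs_fps (\<lambda>n. F $ (3 * n + r))"

lemma section3_nth: "section3 r F $ n = F $ (3 * n + r)"
  by (simp add: section3_def)

lemma section3_add: "section3 r (F + G) = section3 r F + section3 r G"
  and section3_diff: "section3 r (F - G) = section3 r F - section3 r G"
  and section3_const: "section3 r (fps_const c * F) = fps_const c * section3 r F"
  by (simp_all add: fps_eq_iff section3_nth)

lemma section3_X_dilate:
  assumes "i < 3" "r < 3"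
  shows "section3 r (fps_X ^ i * dilate 3 P) = (if i = r then P else 0)"
proof (rule fps_ext)
  fix n
  have "3 dvd 3 * n + r - i \<longleftrightarrow> i = r" if "i \<le> 3 * n + r"
    using assms that by presburger
  with assms show "section3 r (fps_X ^ i * dilate 3 P) $ n = (if i = r then P else 0) $ n"
    by (auto simp: section3_nth fps_X_power_mult_nth dilate_nth)
qed

lemma section3_eqI:
  assumes "F = dilate 3 P0 + fps_X * dilate 3 P1 + fps_X ^ 2 * dilate 3 P2"
  shows "section3 0 F = P0" "section3 1 F = P1" "section3 2 F = P2"
  unfolding assms
  using section3_X_dilate[of 0 _ P0] section3_X_dilate[of 1 _ P1] section3_X_dilate[of 2 _ P2]
  by (simp_all add: section3_add)

lemma section3_expand:
  "F = dilate 3 (section3 0 F) + fps_X * dilate 3 (section3 1 F) + fps_X ^ 2 * dilate 3 (section3 2 F)"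
proof (rule fps_ext)
  fix n
  have X: "fps_X * G = fps_X ^ 1 * G" for G :: "complex fps" by simp
  define k r :: nat where "k = n div 3" and "r = n mod 3"
  then have n: "n = 3 * k + r" "r < 3" by simp_all
  have "section3 r (fps_X ^ i * dilate 3 P) $ k = (if i = r then P $ k else 0)" if "i < 3" for i P
    using section3_X_dilate[OF that n(2), of P] by simp
  then have *: "(fps_X ^ i * dilate 3 P) $ n = (if i = r then P $ k else 0)" if "i < 3" for i P
    using that by (simp add: section3_nth n(1))
  have "r = 0 \<or> r = 1 \<or> r = 2" using n(2) by linarith
  then show "F $ n = (dilate 3 (section3 0 F) + fps_X * dilate 3 (section3 1 F) + fps_X ^ 2 * dilate 3 (section3 2 F)) $ n"
    using *[of 0] *[of 1] *[of 2] by (auto simp: section3_nth n(1))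
qed

lemma section3_dilate_mult:
  assumes "r < 3"
  shows "section3 r (dilate 3 P * F) = P * section3 r F"
proof -
  have "dilate 3 P * F = dilate 3 (P * section3 0 F) + fps_X * dilate 3 (P * section3 1 F)
      + fps_X ^ 2 * dilate 3 (P * section3 2 F)"
    by (subst section3_expand[of F]) (simp add: dilate_rules algebra_simps)
  note section3_eqI[OF this]
  moreover have "r = 0 \<or> r = 1 \<or> r = 2" using assms by linarith
  ultimately show ?thesis by blast
qed

section \<open>Relations between the components of the dissections\<close>

text \<open>The components \<open>A\<close>, \<open>B\<close>, \<open>C\<close>, \<open>D\<close> of \<open>\<psi>(q) = A(q\<^sup>3) + q B(q\<^sup>3)\<close> and
\<open>\<psi>(q\<^sup>2) = C(q\<^sup>3) + q\<^sup>2 D(q\<^sup>3)\<close>.\<close>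

definition thA :: "complex fps" where "thA = ramanujan_f 1 2"

abbreviation "thB \<equiv> dilate 3 psi"
abbreviation "thC \<equiv> dilate 2 thA"
abbreviation "thD \<equiv> dilate 6 psi"
abbreviation "psi2 \<equiv> dilate 2 psi"

lemma psi_ABX: "psi = dilate 3 thA + fps_X * dilate 3 thB"
  using psi_dissection by (simp add: dilate_dilate thA_def)

lemma psi2_CDX: "psi2 = dilate 3 thC + fps_X ^ 2 * dilate 3 thD"
  by (subst psi_ABX) (simp add: dilate_rules dilate_dilate)

lemma psi_nth_0: "psi $ 0 = 1" and thA_nth_0: "thA $ 0 = 1"
  by (simp_all add: psi_def thA_def ramanujan_f_nth_0)

lemma psi_neq_0: "psi \<noteq> 0"
  using psi_nth_0 by auto

lemma dilate_psi_neq_0: "m > 0 \<Longrightarrow> dilate m psi \<noteq> 0"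
  using psi_nth_0 by (metis fps_compose_nth_0 fps_zero_nth zero_neq_one)

lemma psi_4: "thA ^ 3 * thB + fps_X * thB ^ 4 = psi ^ 4"
  using cubic_psi by (simp add: thA_def mult.commute)

lemma psi2_4: "thC ^ 3 * thD + fps_X ^ 2 * thD ^ 4 = psi2 ^ 4"
  using arg_cong[OF psi_4, of "dilate 2"] by (simp add: dilate_rules dilate_dilate)

text \<open>Comparing the three sections of \<open>\<psi>(q)\<^sup>2 = \<phi>(q) \<psi>(q\<^sup>2)\<close> gives three relations between \<open>A\<close>, \<open>B\<close>, \<open>C\<close>,
\<open>D\<close> and the two components of \<open>\<phi>\<close>. This is what remains after eliminating the latter; it is the
equation of a plane curve in \<open>A / B\<close> and \<open>C / D\<close>.\<close>

lemma curve: "thA ^ 2 * thC * thD = thB ^ 2 * thC ^ 2 + 2 * fps_X * thA * thB * thD ^ 2"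
proof -
  let ?P = "dilate 3 phi" and ?E = "ramanujan_f 1 5"
  have phi: "phi = dilate 3 ?P + 2 * fps_X * dilate 3 ?E"
    using phi_dissection by (simp add: dilate_dilate)
  have 1: "psi ^ 2 = dilate 3 (thA ^ 2) + fps_X * dilate 3 (2 * thA * thB) + fps_X ^ 2 * dilate 3 (thB ^ 2)"
    by (subst psi_ABX) (simp add: dilate_rules, algebra)
  have 2: "psi ^ 2 = dilate 3 (?P * thC + 2 * fps_X * ?E * thD) + fps_X * dilate 3 (2 * ?E * thC)
      + fps_X ^ 2 * dilate 3 (?P * thD)"
    unfolding psi_squared by (subst phi, subst psi2_CDX) (simp add: dilate_rules, algebra)
  have "thA ^ 2 = ?P * thC + 2 * fps_X * ?E * thD" "2 * thA * thB = 2 * ?E * thC" "thB ^ 2 = ?P * thD"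
    using section3_eqI[OF 1] section3_eqI[OF 2] by simp_all
  then show ?thesis by algebra
qed

lemma psi_3: "psi ^ 3 = psi2 * (thA * thC + 2 * fps_X * thB * thD)"
proof -
  have "phi * psi = thA * thC + 2 * fps_X * thB * thD"
    using phi_mult_psi by (simp add: thA_def mult_ac)
  with psi_squared show ?thesis by algebra
qed

text \<open>The squares of both sides agree by the cubic identity for \<open>\<psi>(q\<^sup>2)\<close> and the relation \<open>curve\<close>; the
constant terms then determine the sign.\<close>

lemma psi2_2: "psi2 ^ 2 * thB = thD * (thA * thC - fps_X * thB * thD)"
proof -
  have "(psi2 ^ 2 * thB) ^ 2 = (thD * (thA * thC - fps_X * thB * thD)) ^ 2"
    using psi2_4 curve by algebra
  then have "psi2 ^ 2 * thB = thD * (thA * thC - fps_X * thB * thD) \<or>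
      psi2 ^ 2 * thB = - (thD * (thA * thC - fps_X * thB * thD))"
    by (simp only: power2_eq_iff)
  moreover have "(psi2 ^ 2 * thB) $ 0 = 1" "(thD * (thA * thC - fps_X * thB * thD)) $ 0 = 1"
    by (simp_all add: psi_nth_0 thA_nth_0 fps_nth_power_0)
  ultimately show ?thesis
    by (metis fps_neg_nth one_neq_neg_one)
qed

text \<open>Squaring \<open>psi_3\<close> and inserting \<open>psi2_2\<close> expresses \<open>B \<psi>(q) ^ 6\<close> by \<open>A\<close>, \<open>B\<close>, \<open>C\<close>, \<open>D\<close>; the
rest is a polynomial identity modulo \<open>curve\<close>. The particular combination on the right is the one that
arises in the dissection of \<open>\<psi>(q)\<^sup>2 \<psi>(q\<^sup>2)\<^sup>4\<close>.\<close>

lemma psi_6: "psi ^ 6 + 4 * fps_X ^ 3 * thB ^ 2 * thD ^ 4 =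
  thA * thB * thC ^ 4 + 4 * fps_X ^ 2 * thA * thB * thC * thD ^ 3 + 3 * fps_X * thA ^ 2 * thC ^ 2 * thD ^ 2
   + 2 * fps_X * thB ^ 2 * thC ^ 3 * thD" (is "?L = ?R")
proof -
  have "thB * psi ^ 6 = thD * (thA * thC - fps_X * thB * thD) * (thA * thC + 2 * fps_X * thB * thD) ^ 2"
    using psi_3 psi2_2 by algebra
  then have "thB * ?L = thB * ?R"
    using curve by algebra
  then show ?thesis using dilate_psi_neq_0[of 3] by simp
qed

section \<open>The action of the sections on three series\<close>

definition core_pair_series :: "complex fps" where "core_pair_series = psi ^ 2 * psi2 ^ 4"

lemma section3_1_core_pair_series: "section3 1 core_pair_series = 2 * psi ^ 6 + 9 * fps_X ^ 3 * dilate 3 core_pair_series"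
proof -
  let ?s0 = "thC ^ 4 + 4 * fps_X ^ 2 * thC * thD ^ 3" and ?s1 = "6 * fps_X * thC ^ 2 * thD ^ 2"
  let ?s2 = "4 * thC ^ 3 * thD + fps_X ^ 2 * thD ^ 4"
  let ?t0 = "thA ^ 2" and ?t1 = "2 * thA * thB" and ?t2 = "thB ^ 2"
  have "core_pair_series = dilate 3 (?t0 * ?s0 + fps_X * (?t1 * ?s2 + ?t2 * ?s1))
     + fps_X * dilate 3 (?t0 * ?s1 + ?t1 * ?s0 + fps_X * ?t2 * ?s2)
     + fps_X ^ 2 * dilate 3 (?t0 * ?s2 + ?t1 * ?s1 + ?t2 * ?s0)"
    unfolding core_pair_series_def by (subst psi_ABX, subst psi2_CDX) (simp add: dilate_rules, algebra)
  note section3_eqI(2)[OF this]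
  moreover have "dilate 3 core_pair_series = thB ^ 2 * thD ^ 4"
    by (simp add: core_pair_series_def dilate_rules dilate_dilate)
  ultimately show ?thesis
    using psi_6 by algebra
qed

text \<open>The coefficients at the places \<open>9 n + 6\<close>: as \<open>4 (9 n + 6) + 3 = 9 (4 n + 3)\<close>, this multiplies the
arguments \<open>4 n + 3\<close> by 9.\<close>

definition section9 :: "complex fps \<Rightarrow> complex fps" where
  "section9 F = section3 2 (section3 0 F)"

lemma section9_nth: "section9 F $ n = F $ (9 * n + 6)"
  by (simp add: section9_def section3_nth add.commute)

lemma section9_core_pair_series: "section9 (fps_X ^ 3 * dilate 3 core_pair_series) = section3 1 core_pair_series"
proof (rule fps_ext)
  fix n
  have "3 dvd 9 * n + (3::nat)" by presburger
  moreover have "(9 * n + 3) div 3 = 3 * n + 1" by simp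
  ultimately show "section9 (fps_X ^ 3 * dilate 3 core_pair_series) $ n = section3 1 core_pair_series $ n"
    by (simp add: section9_nth section3_nth fps_X_power_mult_nth dilate_nth add.commute)
qed

lemma psi_power_dissections:
  "psi ^ 2 = dilate 3 (thA ^ 2) + fps_X * dilate 3 (2 * thA * thB) + fps_X ^ 2 * dilate 3 (thB ^ 2)"
  "psi ^ 4 = dilate 3 (thA ^ 4 + 4 * fps_X * thA * thB ^ 3)
    + fps_X * dilate 3 (4 * thA ^ 3 * thB + fps_X * thB ^ 4) + fps_X ^ 2 * dilate 3 (6 * thA ^ 2 * thB ^ 2)"
  "psi ^ 6 = dilate 3 (thA ^ 6 + 20 * fps_X * thA ^ 3 * thB ^ 3 + fps_X ^ 2 * thB ^ 6)
    + fps_X * dilate 3 (6 * thA ^ 5 * thB + 15 * fps_X * thA ^ 2 * thB ^ 4)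
    + fps_X ^ 2 * dilate 3 (15 * thA ^ 4 * thB ^ 2 + 6 * fps_X * thA * thB ^ 5)"
  "psi ^ 8 = dilate 3 (thA ^ 8 + 56 * fps_X * thA ^ 5 * thB ^ 3 + 28 * fps_X ^ 2 * thA ^ 2 * thB ^ 6)
    + fps_X * dilate 3 (8 * thA ^ 7 * thB + 70 * fps_X * thA ^ 4 * thB ^ 4 + 8 * fps_X ^ 2 * thA * thB ^ 7)
    + fps_X ^ 2 * dilate 3 (28 * thA ^ 6 * thB ^ 2 + 56 * fps_X * thA ^ 3 * thB ^ 5 + fps_X ^ 2 * thB ^ 8)"
  by (subst psi_ABX, simp add: dilate_rules, algebra)+

text \<open>Series of this shape come out of a first dissection with a factor \<open>B\<^sup>2 = \<psi>(q\<^sup>3)\<^sup>2\<close> in the denominator. A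
second dissection turns this factor, which is a series in \<open>q\<^sup>3\<close>, into \<open>\<psi>(q)\<^sup>2\<close>.\<close>

lemma section3_2_combination:
  assumes "thB ^ 2 * F = fps_const a * psi ^ 8 + fps_const b * (fps_X * psi ^ 4 * thB ^ 4)
      + fps_const c * (fps_X ^ 2 * thB ^ 8)"
  shows "psi ^ 2 * section3 2 F = fps_const a * (28 * psi ^ 8 - 27 * fps_X ^ 2 * thB ^ 8)
      + fps_const b * (4 * psi ^ 8 - 3 * fps_X * psi ^ 4 * thB ^ 4) + fps_const c * psi ^ 8"
proof -
  have "psi ^ 2 * section3 2 F = section3 2 (thB ^ 2 * F)"
    using section3_dilate_mult[of 2 "psi ^ 2" F] by (simp add: dilate_rules)
  also have "\<dots> = fps_const a * section3 2 (psi ^ 8) + fps_const b * section3 2 (fps_X * psi ^ 4 * thB ^ 4)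
      + fps_const c * section3 2 (fps_X ^ 2 * thB ^ 8)"
    unfolding assms by (simp add: section3_add section3_const)
  also have "section3 2 (fps_X ^ 2 * thB ^ 8) = psi ^ 8"
    using section3_X_dilate[of 2 2 "psi ^ 8"] by (simp add: dilate_rules)
  also have "section3 2 (fps_X * psi ^ 4 * thB ^ 4) = psi ^ 4 * section3 2 (fps_X * psi ^ 4)"
    using section3_dilate_mult[of 2 "psi ^ 4" "fps_X * psi ^ 4"] by (simp add: dilate_rules mult_ac)
  also have "section3 2 (fps_X * psi ^ 4) = 4 * thA ^ 3 * thB + fps_X * thB ^ 4"
  proof (rule section3_eqI(3))
    show "fps_X * psi ^ 4 = dilate 3 (fps_X * (6 * thA ^ 2 * thB ^ 2))
      + fps_X * dilate 3 (thA ^ 4 + 4 * fps_X * thA * thB ^ 3)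
      + fps_X ^ 2 * dilate 3 (4 * thA ^ 3 * thB + fps_X * thB ^ 4)"
      by (subst psi_power_dissections(2)) (simp add: dilate_rules, algebra)
  qed
  also have "section3 2 (psi ^ 8) = 28 * thA ^ 6 * thB ^ 2 + 56 * fps_X * thA ^ 3 * thB ^ 5 + fps_X ^ 2 * thB ^ 8"
    by (rule section3_eqI(3)[OF psi_power_dissections(4)])
  also have "\<dots> = 28 * psi ^ 8 - 27 * fps_X ^ 2 * thB ^ 8"
    using psi_4 by algebra
  also have "psi ^ 4 * (4 * thA ^ 3 * thB + fps_X * thB ^ 4) = 4 * psi ^ 8 - 3 * fps_X * psi ^ 4 * thB ^ 4"
    using psi_4 by algebra
  finally show ?thesis .
qed

lemma section3_0_psi_6: "thB ^ 2 * section3 0 (psi ^ 6) = psi ^ 8 + 18 * fps_X * psi ^ 4 * thB ^ 4 - 18 * fps_X ^ 2 * thB ^ 8"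
  using section3_eqI(1)[OF psi_power_dissections(3)] psi_4 by algebra

text \<open>The bracket in the theorem, which is an eigenvector of \<open>section9\<close> with eigenvalue 81.\<close>

definition eigen_series :: "complex fps" where
  "eigen_series = 3 * (euler_f 2 ^ 2 * euler_f 3 ^ 10 / (euler_f 1 ^ 4 * euler_f 6 ^ 2))
         + 4 * fps_X * (euler_f 3 * euler_f 6 ^ 7 / (euler_f 1 * euler_f 2))"

lemma fps_divide_mult_cancel:
  fixes F G :: "complex fps"
  assumes "G $ 0 \<noteq> 0"
  shows "F / G * G = F"
  using assms inverse_mult_eq_1[OF assms] by (simp add: fps_divide_unit mult.assoc)

lemma euler_f_nth_0: "m \<ge> 1 \<Longrightarrow> euler_f m $ 0 = 1"
  by (rule euler_f_has_prod(2))

lemma psi_euler_f: "m \<ge> 1 \<Longrightarrow> dilate m psi * euler_f m = euler_f (2 * m) ^ 2"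
  using arg_cong[OF ramanujan_f_1_3_euler_f, of "dilate m"]
  by (simp add: dilate_rules dilate_euler_f mult.commute flip: psi_def)

text \<open>By the product formulas the left side is \<open>A\<^sup>3 B (3 A\<^sup>3 B + 4 q B\<^sup>4)\<close>, and \<open>A\<^sup>3 B = \<psi>\<^sup>4 - q B\<^sup>4\<close>.\<close>

lemma psi_2_eigen_series: "psi ^ 2 * eigen_series = 3 * psi ^ 8 - 2 * fps_X * psi ^ 4 * thB ^ 4 - fps_X ^ 2 * thB ^ 8"
proof -
  let ?K1 = "euler_f 2 ^ 2 * euler_f 3 ^ 10 / (euler_f 1 ^ 4 * euler_f 6 ^ 2)"
  let ?K2 = "euler_f 3 * euler_f 6 ^ 7 / (euler_f 1 * euler_f 2)"
  have x: "psi * euler_f 1 = euler_f 2 ^ 2"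
    using psi_euler_f[of 1] by simp
  have B: "thB * euler_f 3 = euler_f 6 ^ 2"
    using psi_euler_f[of 3] by simp
  have A: "thA * euler_f 1 * euler_f 6 = euler_f 2 * euler_f 3 ^ 2"
    using ramanujan_f_1_2_euler_f by (simp add: thA_def)
  have K1: "?K1 * (euler_f 1 ^ 4 * euler_f 6 ^ 2) = euler_f 2 ^ 2 * euler_f 3 ^ 10"
    by (rule fps_divide_mult_cancel) (simp add: euler_f_nth_0 fps_nth_power_0)
  have K2: "?K2 * (euler_f 1 * euler_f 2) = euler_f 3 * euler_f 6 ^ 7"
    by (rule fps_divide_mult_cancel) (simp add: euler_f_nth_0)
  have nz: "euler_f 1 \<noteq> 0" "euler_f 2 \<noteq> 0" "euler_f 3 \<noteq> 0" "euler_f 6 \<noteq> 0"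
    using euler_f_nth_0[of 1] euler_f_nth_0[of 2] euler_f_nth_0[of 3] euler_f_nth_0[of 6] by auto
  have "psi ^ 2 * ?K1 = thA ^ 6 * thB ^ 2"
  proof -
    have "psi ^ 2 * ?K1 * (euler_f 1 ^ 6 * euler_f 6 ^ 6 * euler_f 3 ^ 2) =
      (psi * euler_f 1) ^ 2 * (?K1 * (euler_f 1 ^ 4 * euler_f 6 ^ 2)) * euler_f 6 ^ 4 * euler_f 3 ^ 2"
      by algebra
    also have "\<dots> = (thA * euler_f 1 * euler_f 6) ^ 6 * (thB * euler_f 3) ^ 2"
      unfolding x K1 A B by algebra
    also have "\<dots> = thA ^ 6 * thB ^ 2 * (euler_f 1 ^ 6 * euler_f 6 ^ 6 * euler_f 3 ^ 2)"
      by algebra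
    finally show ?thesis using nz by simp
  qed
  moreover have "psi ^ 2 * ?K2 = thA ^ 3 * thB ^ 5"
  proof -
    have "psi ^ 2 * ?K2 * (euler_f 1 ^ 3 * euler_f 2 * euler_f 6 ^ 3 * euler_f 3 ^ 5) =
      (psi * euler_f 1) ^ 2 * (?K2 * (euler_f 1 * euler_f 2)) * euler_f 6 ^ 3 * euler_f 3 ^ 5"
      by algebra
    also have "\<dots> = (thA * euler_f 1 * euler_f 6) ^ 3 * (thB * euler_f 3) ^ 5 * euler_f 2"
      unfolding x K2 A B by algebra
    also have "\<dots> = thA ^ 3 * thB ^ 5 * (euler_f 1 ^ 3 * euler_f 2 * euler_f 6 ^ 3 * euler_f 3 ^ 5)"
      by algebra
    finally show ?thesis using nz by simp
  qed
  ultimately have "psi ^ 2 * eigen_series = 3 * (thA ^ 6 * thB ^ 2) + 4 * fps_X * (thA ^ 3 * thB ^ 5)"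
    unfolding eigen_series_def by algebra
  then show ?thesis using psi_4 by algebra
qed

lemma section9_psi_6: "section9 (psi ^ 6) = psi ^ 6 + 27 * eigen_series"
proof -
  have "psi ^ 2 * section3 2 (section3 0 (psi ^ 6)) = fps_const 1 * (28 * psi ^ 8 - 27 * fps_X ^ 2 * thB ^ 8)
      + fps_const 18 * (4 * psi ^ 8 - 3 * fps_X * psi ^ 4 * thB ^ 4) + fps_const (- 18) * psi ^ 8"
    by (rule section3_2_combination)
      (simp add: section3_0_psi_6 mult.assoc numeral_fps_const[symmetric] flip: fps_const_neg)
  also have "\<dots> = psi ^ 2 * (psi ^ 6 + 27 * eigen_series)"
    using psi_2_eigen_series by (simp add: numeral_fps_const[symmetric] flip: fps_const_neg) algebra
  finally show ?thesis
    using psi_neq_0 by (simp add: section9_def)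
qed

text \<open>Solving \<open>psi_2_eigen_series\<close> for the series leaves the denominator \<open>\<psi>(q)\<^sup>2\<close>, which is not a series in
\<open>q\<^sup>3\<close>. Multiplying by the square of \<open>u = a\<^sup>2 - q a b + q\<^sup>2 b\<^sup>2\<close>, where \<open>\<psi>(q) = a + q b\<close>, replaces it by
the norm \<open>a\<^sup>3 + q\<^sup>3 b\<^sup>3\<close>.\<close>

lemma section3_0_eigen_series: "thB ^ 2 * section3 0 eigen_series = 3 * psi ^ 8 + 54 * fps_X * psi ^ 4 * thB ^ 4 - 57 * fps_X ^ 2 * thB ^ 8"
proof -
  let ?N = "thA ^ 3 + fps_X * thB ^ 3"
  let ?u = "dilate 3 thA ^ 2 - fps_X * dilate 3 thA * dilate 3 thB + fps_X ^ 2 * dilate 3 thB ^ 2"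
  have N: "dilate 3 ?N = psi * ?u"
    by (subst psi_ABX) (simp add: dilate_rules, algebra)
  have "dilate 3 (?N ^ 2) * eigen_series = ?u ^ 2 * (psi ^ 2 * eigen_series)"
    unfolding dilate_rules(4)[OF zero_less_numeral] N by algebra
  also have "\<dots> = dilate 3 (?N ^ 2) * (3 * psi ^ 6 - 2 * fps_X * psi ^ 2 * thB ^ 4) - fps_X ^ 2 * thB ^ 8 * ?u ^ 2"
    unfolding dilate_rules(4)[OF zero_less_numeral] N psi_2_eigen_series by algebra
  finally have 1: "dilate 3 (?N ^ 2) * eigen_series =
    dilate 3 (?N ^ 2) * (3 * psi ^ 6 - 2 * fps_X * psi ^ 2 * thB ^ 4) - dilate 3 (psi ^ 8) * (fps_X ^ 2 * ?u ^ 2)"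
    by (simp add: dilate_rules mult_ac)
  have 2: "section3 0 (fps_X ^ 2 * ?u ^ 2) = fps_X * (fps_X * thB ^ 4 - 2 * thA ^ 3 * thB)"
  proof (rule section3_eqI(1))
    show "fps_X ^ 2 * ?u ^ 2 = dilate 3 (fps_X * (fps_X * thB ^ 4 - 2 * thA ^ 3 * thB))
      + fps_X * dilate 3 (fps_X * (3 * thA ^ 2 * thB ^ 2))
      + fps_X ^ 2 * dilate 3 (thA ^ 4 - 2 * fps_X * thA * thB ^ 3)"
      by (simp add: dilate_rules, algebra)
  qed
  have 3: "section3 0 (fps_X * psi ^ 2) = fps_X * thB ^ 2"
  proof (rule section3_eqI(1))
    show "fps_X * psi ^ 2 = dilate 3 (fps_X * thB ^ 2) + fps_X * dilate 3 (thA ^ 2) + fps_X ^ 2 * dilate 3 (2 * thA * thB)"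
      by (subst psi_power_dissections(1)) (simp add: dilate_rules, algebra)
  qed
  have 4: "section3 0 (3 * psi ^ 6 - 2 * fps_X * psi ^ 2 * thB ^ 4) = 3 * section3 0 (psi ^ 6) - 2 * fps_X * psi ^ 4 * thB ^ 2"
  proof -
    have "section3 0 (3 * psi ^ 6 - 2 * fps_X * psi ^ 2 * thB ^ 4) =
      section3 0 (fps_const 3 * psi ^ 6) - section3 0 (fps_const 2 * (dilate 3 (psi ^ 4) * (fps_X * psi ^ 2)))"
      by (simp add: section3_diff dilate_rules mult_ac numeral_fps_const[symmetric])
    then show ?thesis
      unfolding section3_const section3_dilate_mult[OF zero_less_numeral] 3
      by (simp add: mult_ac numeral_fps_const[symmetric])
  qed
  have "?N ^ 2 * section3 0 eigen_series =
    ?N ^ 2 * (3 * section3 0 (psi ^ 6) - 2 * fps_X * psi ^ 4 * thB ^ 2)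
     - psi ^ 8 * (fps_X * (fps_X * thB ^ 4 - 2 * thA ^ 3 * thB))"
    using arg_cong[OF 1, of "section3 0"]
    unfolding section3_diff[of 0 "dilate 3 P * Q" for P Q] section3_dilate_mult[OF zero_less_numeral] 2 4 .
  then have "(thB * ?N) ^ 2 * section3 0 eigen_series = (thB * ?N) ^ 2 * (3 * section3 0 (psi ^ 6) - 2 * fps_X * psi ^ 4 * thB ^ 2)
     - psi ^ 8 * (fps_X * (fps_X * thB ^ 4 - 2 * thA ^ 3 * thB)) * thB ^ 2"
    by algebra
  moreover have "thB * ?N = psi ^ 4"
    using psi_4 by algebra
  ultimately have "psi ^ 8 * section3 0 eigen_series = psi ^ 8 * (3 * section3 0 (psi ^ 6) - 2 * fps_X * psi ^ 4 * thB ^ 2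
      - fps_X * (fps_X * thB ^ 4 - 2 * thA ^ 3 * thB) * thB ^ 2)"
    by algebra
  then have "section3 0 eigen_series = 3 * section3 0 (psi ^ 6) - 2 * fps_X * psi ^ 4 * thB ^ 2
      - fps_X * (fps_X * thB ^ 4 - 2 * thA ^ 3 * thB) * thB ^ 2"
    using psi_neq_0 by simp
  then show ?thesis
    using section3_0_psi_6 psi_4 by algebra
qed

lemma section9_eigen_series: "section9 eigen_series = 81 * eigen_series"
proof -
  have "psi ^ 2 * section3 2 (section3 0 eigen_series) = fps_const 3 * (28 * psi ^ 8 - 27 * fps_X ^ 2 * thB ^ 8)
      + fps_const 54 * (4 * psi ^ 8 - 3 * fps_X * psi ^ 4 * thB ^ 4) + fps_const (- 57) * psi ^ 8"
    by (rule section3_2_combination)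
      (simp add: section3_0_eigen_series mult.assoc numeral_fps_const[symmetric] flip: fps_const_neg)
  also have "\<dots> = psi ^ 2 * (81 * eigen_series)"
    using psi_2_eigen_series by (simp add: numeral_fps_const[symmetric] flip: fps_const_neg) algebra
  finally show ?thesis
    using psi_neq_0 by (simp add: section9_def)
qed

text \<open>On the span of \<open>\<psi>\<^sup>6\<close>, \<open>eigen_series\<close> and \<open>q\<^sup>3 core_pair_series(q\<^sup>3)\<close> the operator \<open>section9\<close> is
triangular with eigenvalues 1, 81 and 9, so the coordinates of its iterates are in closed form.\<close>

lemma section9_iterates:
  fixes S :: "nat \<Rightarrow> complex fps"
  assumes "S 0 = section3 1 core_pair_series" "\<And>k. S (Suc k) = section9 (S k)"
  shows "S k = fps_const ((3 ^ (2 * k + 2) - 1) / 4) * psi ^ 6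
    + fps_const (27 * (3 ^ (2 * k) - 1) * (3 ^ (2 * k + 2) - 1) / 320) * eigen_series
    + fps_const (3 ^ (2 * k + 2)) * (fps_X ^ 3 * dilate 3 core_pair_series)"
proof (induction k)
  case 0
  have "section3 1 core_pair_series = fps_const 2 * psi ^ 6 + fps_const 9 * (fps_X ^ 3 * dilate 3 core_pair_series)"
    by (simp add: section3_1_core_pair_series numeral_fps_const[symmetric] mult_ac)
  then show ?case by (simp add: assms(1))
next
  case (Suc k)
  define t :: complex where "t = 3 ^ (2 * k)"
  have t: "3 ^ (2 * k) = t" "3 ^ (2 * k + 2) = 9 * t" "3 ^ (2 * Suc k) = 9 * t" "3 ^ (2 * Suc k + 2) = 81 * t"
    by (simp_all add: t_def power_add)
  let ?c = "(9 * t - 1) / 4" and ?d = "27 * (t - 1) * (9 * t - 1) / 320"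
  have lin: "section9 (F + G) = section9 F + section9 G" "section9 (fps_const c * F) = fps_const c * section9 F" for F G c
    by (simp_all add: section9_def section3_add section3_const)
  have "S (Suc k) = section9 (fps_const ?c * psi ^ 6 + fps_const ?d * eigen_series + fps_const (9 * t) * (fps_X ^ 3 * dilate 3 core_pair_series))"
    unfolding assms(2) Suc t ..
  also have "\<dots> = fps_const ?c * (psi ^ 6 + fps_const 27 * eigen_series) + fps_const ?d * (fps_const 81 * eigen_series)
     + fps_const (9 * t) * (fps_const 2 * psi ^ 6 + fps_const 9 * (fps_X ^ 3 * dilate 3 core_pair_series))"
    unfolding lin section9_psi_6 section9_eigen_series section9_core_pair_series section3_1_core_pair_series by (simp add: numeral_fps_const[symmetric] mult_ac)
  also have "\<dots> = fps_const (?c + 9 * t * 2) * psi ^ 6 + fps_const (?c * 27 + ?d * 81) * eigen_series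
     + fps_const (9 * t * 9) * (fps_X ^ 3 * dilate 3 core_pair_series)"
    by (simp only: fps_const_add[symmetric] fps_const_mult[symmetric]) algebra
  also have "?c + 9 * t * 2 = (81 * t - 1) / 4"
    by (simp add: field_simps)
  also have "?c * 27 + ?d * 81 = 27 * (9 * t - 1) * (81 * t - 1) / 320"
    by (simp add: field_simps)
  finally show ?case unfolding t by (simp add: mult_ac)
qed

lemma psi_6_euler_f: "psi ^ 6 = euler_f 2 ^ 12 / euler_f 1 ^ 6"
proof -
  have "euler_f 2 ^ 12 / euler_f 1 ^ 6 * euler_f 1 ^ 6 = euler_f 2 ^ 12"
    by (rule fps_divide_mult_cancel) (simp add: euler_f_nth_0 fps_nth_power_0)
  also have "\<dots> = psi ^ 6 * euler_f 1 ^ 6"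
    using psi_euler_f[of 1] by simp algebra
  finally show ?thesis using euler_f_nth_0[of 1] by auto
qed

lemma core_pair_series_euler_f: "dilate 3 core_pair_series = euler_f 12 ^ 8 / euler_f 3 ^ 2"
proof -
  have nz: "euler_f 3 \<noteq> 0" "euler_f 6 \<noteq> 0"
    using euler_f_nth_0[of 3] euler_f_nth_0[of 6] by auto
  have "dilate 3 core_pair_series = thB ^ 2 * thD ^ 4"
    by (simp add: core_pair_series_def dilate_rules dilate_dilate)
  then have "dilate 3 core_pair_series * (euler_f 3 ^ 2 * euler_f 6 ^ 4) = (thB * euler_f 3) ^ 2 * (thD * euler_f 6) ^ 4"
    by algebra
  also have "\<dots> = (euler_f 6 ^ 2) ^ 2 * (euler_f 12 ^ 2) ^ 4"
    using psi_euler_f[of 3] psi_euler_f[of 6] by simp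
  also have "\<dots> = euler_f 12 ^ 8 * euler_f 6 ^ 4"
    by algebra
  also have "euler_f 12 ^ 8 = euler_f 12 ^ 8 / euler_f 3 ^ 2 * euler_f 3 ^ 2"
    by (rule fps_divide_mult_cancel[symmetric]) (simp add: euler_f_nth_0 fps_nth_power_0)
  finally have "dilate 3 core_pair_series * (euler_f 3 ^ 2 * euler_f 6 ^ 4) = euler_f 12 ^ 8 / euler_f 3 ^ 2 * (euler_f 3 ^ 2 * euler_f 6 ^ 4)"
    by (simp only: mult.assoc)
  then show ?thesis using nz by simp
qed

section \<open>A lattice sum for 4-cores\<close>

text \<open>The form \<open>\<Sum>r<4. 2 n\<^sub>r\<^sup>2 + r n\<^sub>r\<close> on the integer vectors with \<open>n\<^sub>0 + n\<^sub>1 + n\<^sub>2 + n\<^sub>3 = 0\<close>, with \<open>n\<^sub>0\<close>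
eliminated. It is the size of the 4-core whose runners are shifted by the numbers \<open>n\<^sub>r\<close>.\<close>

definition core_exp :: "int \<times> int \<times> int \<Rightarrow> int" where
  "core_exp = (\<lambda>(a, b, c). 2 * ((a + b + c) ^ 2 + a ^ 2 + b ^ 2 + c ^ 2) + a + 2 * b + 3 * c)"

text \<open>Because the four coordinates add up to 0, the form does not change if \<open>3 / 2\<close> is subtracted from each
\<open>r\<close>; then twice each summand is at least the absolute value of its coordinate.\<close>

lemma core_exp_bound:
  "\<bar>a\<bar> + \<bar>b\<bar> + \<bar>c\<bar> + \<bar>a + b + c\<bar> \<le> 2 * core_exp (a, b, c)"
proof -
  have sq: "\<bar>x\<bar> \<le> x ^ 2" for x :: int
    using mult_mono[of 1 "\<bar>x\<bar>" "\<bar>x\<bar>" "\<bar>x\<bar>"] by (cases "x = 0") (auto simp: power2_eq_square)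
  have *: "\<bar>x\<bar> \<le> 4 * x ^ 2 + u * x" if "\<bar>u\<bar> \<le> 3" for x u :: int
  proof -
    have "\<bar>u * x\<bar> \<le> 3 * \<bar>x\<bar>"
      unfolding abs_mult by (rule mult_right_mono) (use that in auto)
    then show ?thesis using sq[of x] by linarith
  qed
  have "2 * core_exp (a, b, c) = (4 * (a + b + c) ^ 2 + 3 * (a + b + c))
      + (4 * a ^ 2 + (- 1) * a) + (4 * b ^ 2 + 1 * b) + (4 * c ^ 2 + 3 * c)"
    by (simp add: core_exp_def algebra_simps)
  then show ?thesis
    using *[of 3 "a + b + c"] *[of "- 1" a] *[of 1 b] *[of 3 c] by linarith
qed

lemma admissible_core_exp: "admissible UNIV core_exp"
proof -
  have "finite {v. core_exp v = n}" for n
  proof (rule finite_subset)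
    show "{v. core_exp v = n} \<subseteq> {- (2 * n)..2 * n} \<times> {- (2 * n)..2 * n} \<times> {- (2 * n)..2 * n}"
    proof
      fix v assume v: "v \<in> {v. core_exp v = n}"
      obtain a b c where abc: "v = (a, b, c)" by (cases v)
      with v core_exp_bound[of a b c] have "\<bar>a\<bar> + \<bar>b\<bar> + \<bar>c\<bar> + \<bar>a + b + c\<bar> \<le> 2 * n" by simp
      then have "\<bar>a\<bar> \<le> 2 * n" "\<bar>b\<bar> \<le> 2 * n" "\<bar>c\<bar> \<le> 2 * n" by linarith+
      then show "v \<in> {- (2 * n)..2 * n} \<times> {- (2 * n)..2 * n} \<times> {- (2 * n)..2 * n}"
        unfolding abc abs_le_iff by simp
    qed
  qed simp
  moreover have "0 \<le> core_exp v" for v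
    using core_exp_bound by (cases v) (smt (verit))
  ultimately show ?thesis by (simp add: admissible_def)
qed

text \<open>Completing squares in \<open>8 core_exp + 5\<close> gives a form on a translate of the root lattice \<open>A\<^sub>3\<close>. Since
this lattice is also \<open>D\<^sub>3\<close>, the three sums of \<open>n\<^sub>0\<close> with another coordinate are orthogonal to each
other; replacing two of them by their half sum and half difference yields \<open>x\<^sup>2 + 2 y\<^sup>2 + 2 z\<^sup>2\<close> with odd \<open>x\<close>, \<open>y\<close>, \<open>z\<close>, which is the form of
\<open>\<psi>(q) \<psi>(q\<^sup>2)\<^sup>2\<close>. The signs of \<open>y\<close> and \<open>z\<close> depend on the parity of the index that belongs to \<open>x\<close>.\<close>

lemma theta_core_exp: "theta UNIV core_exp = psi * psi2 ^ 2"
proof -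
  let ?R1 = "\<lambda>(i, d, e). 8 * i * i - 2 * i + (4 * d * d - 2 * d) + (4 * e * e - 2 * e) :: int"
  let ?R2 = "\<lambda>(i, d, e). 8 * i * i + 6 * i + 1 + (4 * d * d - 2 * d) + (4 * e * e - 2 * e) :: int"
  let ?Q = "\<lambda>(b, p). theta_exp 1 3 b + (case p of (d, e) \<Rightarrow> theta_exp 2 6 d + theta_exp 2 6 e)"
  have "theta UNIV core_exp = theta UNIV ?R1 + theta UNIV ?R2"
  proof (rule theta_split2[OF admissible_core_exp])
    show "core_exp (case p of (i, d, e) \<Rightarrow> (e - i, i - d, - e - i)) = ?R1 p" for p
      by (cases p) (simp add: core_exp_def power2_eq_square algebra_simps)
    show "core_exp (case p of (i, d, e) \<Rightarrow> (- e - i, i + d, e - i - 1)) = ?R2 p" for p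
      by (cases p) (simp add: core_exp_def power2_eq_square algebra_simps)
    show "(case x of (i, d, e) \<Rightarrow> (e - i, i - d, - e - i)) \<noteq> (case y of (i, d, e) \<Rightarrow> (- e - i, i + d, e - i - 1))"
      for x y :: "int \<times> int \<times> int"
      by (cases x; cases y; simp) presburger
    show "v \<in> range (\<lambda>(i, d, e). (e - i, i - d, - e - i)) \<or> v \<in> range (\<lambda>(i, d, e). (- e - i, i + d, e - i - 1))"
      for v :: "int \<times> int \<times> int"
    proof (cases v)
      case (fields a b c)
      have "(\<exists>i. a + c = - 2 * i) \<or> (\<exists>i. a + c = - 2 * i - 1)" by presburger
      then consider i where "a + c = - 2 * i" | i where "a + c = - 2 * i - 1" by blast
      then show ?thesis
      proof cases
        case 1
        then have "v = (case (i, i - b, a + i) of (i, d, e) \<Rightarrow> (e - i, i - d, - e - i))"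
          using fields by simp
        then show ?thesis by blast
      next
        case 2
        then have "v = (case (i, b - i, - a - i) of (i, d, e) \<Rightarrow> (- e - i, i + d, e - i - 1))"
          using fields by simp
        then show ?thesis by blast
      qed
    qed
  qed (auto simp: inj_on_def)
  also have "\<dots> = theta UNIV ?Q"
  proof (rule theta_split2[symmetric])
    show "admissible UNIV ?Q"
      using admissible_Times[OF admissible_theta_exp[of 1 3] admissible_theta_exp2[of 2 6 2 6]] by simp
    show "?Q (case p of (i, d, e) \<Rightarrow> (2 * i, d, e)) = ?R1 p" for p
      by (cases p) (simp add: theta_exp_scaled theta_exp_1_3 algebra_simps)
    show "?Q (case p of (i, d, e) \<Rightarrow> (2 * i + 1, d, e)) = ?R2 p" for p
      by (cases p) (simp add: theta_exp_scaled theta_exp_1_3 algebra_simps)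
    show "(case x of (i, d, e) \<Rightarrow> (2 * i, d, e)) \<noteq> (case y of (i, d, e) \<Rightarrow> (2 * i + 1, d, e))"
      for x y :: "int \<times> int \<times> int"
      by (cases x; cases y; simp) presburger
    show "v \<in> range (\<lambda>(i, d, e). (2 * i, d, e)) \<or> v \<in> range (\<lambda>(i, d, e). (2 * i + 1, d, e))"
      for v :: "int \<times> int \<times> int"
      by (cases v; simp add: image_iff) presburger
  qed (auto simp: inj_on_def)
  also have "\<dots> = psi * psi2 ^ 2"
  proof -
    have "psi2 ^ 2 = theta UNIV (\<lambda>(d, e). theta_exp 2 6 d + theta_exp 2 6 e)"
      using ramanujan_f_mult[of 2 6 2 6]
      by (simp add: psi_def dilate_ramanujan_f power2_eq_square[of "ramanujan_f 2 6"])
    then have "psi * psi2 ^ 2 = theta UNIV (theta_exp 1 3) * theta UNIV (\<lambda>(d, e). theta_exp 2 6 d + theta_exp 2 6 e)"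
      by (simp add: psi_def ramanujan_f_def)
    then show ?thesis
      by (simp add: theta_mult admissible_theta_exp admissible_theta_exp2)
  qed
  finally show ?thesis .
qed

section \<open>Beta sets\<close>

text \<open>The positions of the beads; for a list without zeros they are the hook lengths in the first column of
the diagram. Trailing zeros shift all positions, so only lists of a common length are compared.\<close>

fun beta_set :: "nat list \<Rightarrow> nat set" where
  "beta_set [] = {}"
| "beta_set (x # xs) = insert (x + length xs) (beta_set xs)"

lemma beta_set_less: "(\<forall>y\<in>set xs. y \<le> x) \<Longrightarrow> b \<in> beta_set xs \<Longrightarrow> b < x + length xs"
  by (induction xs) force+

lemma finite_beta_set [simp]: "finite (beta_set xs)"
  by (induction xs) auto

lemma beta_set_notin:
  assumes "sorted_wrt (\<ge>) (x # xs)"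
  shows "x + length xs \<notin> beta_set xs"
  using beta_set_less[of xs x "x + length xs"] assms by auto

lemma card_beta_set: "sorted_wrt (\<ge>) xs \<Longrightarrow> card (beta_set xs) = length xs"
proof (induction xs)
  case (Cons x xs)
  then show ?case using beta_set_notin[of x xs] by simp
qed simp

lemma sum_beta_set: "sorted_wrt (\<ge>) xs \<Longrightarrow> \<Sum>(beta_set xs) = sum_list xs + (length xs choose 2)"
proof (induction xs)
  case (Cons x xs)
  have "Suc (length xs) choose 2 = length xs + (length xs choose 2)" by (simp add: numeral_2_eq_2 One_nat_def)
  then show ?case using Cons beta_set_notin[of x xs] by simp
qed (simp add: binomial_eq_0)

lemma Max_beta_set:
  assumes "sorted_wrt (\<ge>) (x # xs)"
  shows "Max (beta_set (x # xs)) = x + length xs"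
  using beta_set_less[of xs x] assms by (intro Max_eqI) (auto intro: less_imp_le)

lemma beta_set_inject:
  "sorted_wrt (\<ge>) xs \<Longrightarrow> sorted_wrt (\<ge>) ys \<Longrightarrow> length xs = length ys \<Longrightarrow> beta_set xs = beta_set ys \<Longrightarrow> xs = ys"
proof (induction xs arbitrary: ys)
  case (Cons x xs)
  then obtain y ys' where ys: "ys = y # ys'" by (cases ys) auto
  have "x = y"
    using Max_beta_set[of x xs] Max_beta_set[of y ys'] Cons.prems ys by simp
  moreover have "beta_set xs = beta_set ys'"
  proof -
    have "beta_set xs = beta_set (x # xs) - {x + length xs}" using beta_set_notin[OF Cons.prems(1)] by auto
    also have "\<dots> = beta_set (y # ys') - {y + length ys'}" using Cons.prems ys \<open>x = y\<close> by simp
    also have "\<dots> = beta_set ys'" using beta_set_notin[of y ys'] Cons.prems ys by auto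
    finally show ?thesis .
  qed
  ultimately show ?case using Cons ys by auto
qed simp

lemma beta_set_surj:
  "finite X \<Longrightarrow> \<exists>xs. sorted_wrt (\<ge>) xs \<and> length xs = card X \<and> beta_set xs = X"
proof (induction "card X" arbitrary: X)
  case 0
  then show ?case by (intro exI[of _ "[]"]) simp
next
  case (Suc N)
  define m where "m = Max X"
  have X: "X \<noteq> {}" using Suc by auto
  have m: "m \<in> X" unfolding m_def using Suc X by simp
  have "card (X - {m}) = N" using Suc m by simp
  with Suc obtain xs where xs: "sorted_wrt (\<ge>) xs" "length xs = N" "beta_set xs = X - {m}"
    by (metis finite_Diff)
  have less: "b < m" if "b \<in> beta_set xs" for b
    using that xs Suc(3) Max_ge[of X b] m_def by (metis Diff_iff insertI1 le_neq_implies_less)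
  have "y + N \<le> m" if "xs = y # ys" for y ys
    using less[of "y + length ys"] that xs(2) by auto
  moreover have "N \<le> m"
  proof (cases xs)
    case Nil
    then show ?thesis using xs by simp
  next
    case (Cons y ys)
    then show ?thesis using calculation by force
  qed
  ultimately have "sorted_wrt (\<ge>) ((m - N) # xs)" "beta_set ((m - N) # xs) = X" "length ((m - N) # xs) = card X"
    using xs m Suc(2) by (cases xs; force)+
  then show ?case by blast
qed

lemma mem_beta_set_iff: "b \<in> beta_set xs \<longleftrightarrow> (\<exists>i<length xs. b = xs ! i + (length xs - 1 - i))"
proof (induction xs)
  case (Cons x xs)
  have "(\<exists>i<length (x # xs). b = (x # xs) ! i + (length (x # xs) - 1 - i)) \<longleftrightarrow>
     b = x + length xs \<or> (\<exists>i<length xs. b = xs ! i + (length xs - 1 - i))"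
    by (auto simp: less_Suc_eq_0_disj)
  then show ?case using Cons by simp
qed simp

section \<open>Hooks as pairs of a bead and a gap\<close>

text \<open>The number \<open>k\<close> is the height of column \<open>j\<close>.\<close>

lemma hook_length_eq:
  assumes "k \<le> length xs" "i < k" "\<And>i'. i' < k \<Longrightarrow> j < xs ! i'" "\<And>i'. k \<le> i' \<Longrightarrow> i' < length xs \<Longrightarrow> xs ! i' \<le> j"
  shows "hook_length xs i j = (xs ! i - j) + (k - i - 1)"
proof -
  have "hook xs i j = {i} \<times> {j..<xs ! i} \<union> {i<..<k} \<times> {j}"
    using assms unfolding hook_def cells_def by (force simp: not_le[symmetric])
  moreover have "card \<dots> = card ({i} \<times> {j..<xs ! i}) + card ({i<..<k} \<times> {j})"
    by (rule card_Un_disjoint) auto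
  ultimately show ?thesis
    by (simp add: hook_length_def card_cartesian_product)
qed

lemma column_height:
  fixes xs :: "nat list"
  assumes "sorted_wrt (\<ge>) xs"
  obtains k where "k \<le> length xs" "\<And>i. i < k \<Longrightarrow> j < xs ! i" "\<And>i. k \<le> i \<Longrightarrow> i < length xs \<Longrightarrow> xs ! i \<le> j"
proof -
  define k where "k = (LEAST k. k = length xs \<or> xs ! k \<le> j)"
  have k: "k = length xs \<or> xs ! k \<le> j"
    unfolding k_def by (rule LeastI[of _ "length xs"]) simp
  have k': "k \<le> length xs"
    unfolding k_def by (rule Least_le) simp
  show ?thesis
  proof (rule that[OF k'])
    show "j < xs ! i" if "i < k" for i
      using not_less_Least[of i "\<lambda>k. k = length xs \<or> xs ! k \<le> j"] that unfolding k_def by auto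
    show "xs ! i \<le> j" if "k \<le> i" "i < length xs" for i
    proof -
      have "xs ! i \<le> xs ! k"
        using assms that sorted_wrt_nth_less[of "(\<ge>)" xs k i] by (cases "k = i") auto
      then show ?thesis using k that by auto
    qed
  qed
qed

definition flush :: "nat \<Rightarrow> nat set \<Rightarrow> bool" where
  "flush t X \<longleftrightarrow> (\<forall>x. x + t \<in> X \<longrightarrow> x \<in> X)"

lemma flush_mult: "flush t X \<Longrightarrow> x + t * m \<in> X \<Longrightarrow> x \<in> X"
proof (induction m)
  case (Suc m)
  then show ?case using Suc(1) by (simp add: flush_def algebra_simps)
qed simp

text \<open>A hook in row \<open>i\<close> and column \<open>j\<close> reaches from the bead of row \<open>i\<close> down to the gap that belongs to
column \<open>j\<close>. If that column has height \<open>k\<close>, the gap is at \<open>length xs - k + j\<close>.\<close>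

lemma hook_gap:
  assumes "sorted_wrt (\<ge>) xs" "(i, j) \<in> cells xs"
  obtains y where "y \<notin> beta_set xs" "y + hook_length xs i j = xs ! i + (length xs - 1 - i)" "hook_length xs i j > 0"
proof -
  obtain k where k: "k \<le> length xs" "\<And>i. i < k \<Longrightarrow> j < xs ! i" "\<And>i. k \<le> i \<Longrightarrow> i < length xs \<Longrightarrow> xs ! i \<le> j"
    using column_height[OF assms(1), of j] by blast
  have i: "i < length xs" "j < xs ! i" using assms(2) by (auto simp: cells_def)
  then have ik: "i < k" using k(3)[of i] by (meson leD leI)
  have h: "hook_length xs i j = (xs ! i - j) + (k - i - 1)"
    by (rule hook_length_eq) (use k ik in auto)
  show ?thesis
  proof
    show "length xs - k + j \<notin> beta_set xs"
    proof
      assume "length xs - k + j \<in> beta_set xs"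
      then obtain i' where i': "i' < length xs" "length xs - k + j = xs ! i' + (length xs - 1 - i')"
        by (auto simp: mem_beta_set_iff)
      show False
      proof (cases "i' < k")
        case True
        then show False using k(2)[of i'] i' k(1) by linarith
      next
        case False
        then show False using k(3)[of i'] i' by linarith
      qed
    qed
    show "length xs - k + j + hook_length xs i j = xs ! i + (length xs - 1 - i)"
      using h i ik k(1) by linarith
    show "hook_length xs i j > 0" using h i by linarith
  qed
qed

text \<open>Conversely, if \<open>k\<close> beads lie above a gap \<open>y\<close>, then \<open>y\<close> belongs to the column \<open>y + k - length xs\<close>.\<close>

lemma gap_hook:
  assumes "sorted_wrt (\<ge>) xs" "y \<notin> beta_set xs" "y < x" "x \<in> beta_set xs"
  obtains i j where "(i, j) \<in> cells xs" "y + hook_length xs i j = x"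
proof -
  let ?N = "length xs"
  let ?b = "\<lambda>i. xs ! i + (?N - 1 - i)"
  obtain i where i: "i < ?N" "x = ?b i" using assms(4) by (auto simp: mem_beta_set_iff)
  define k where "k = (LEAST k. k = ?N \<or> ?b k \<le> y)"
  have k: "k = ?N \<or> ?b k \<le> y"
    unfolding k_def by (rule LeastI[of _ ?N]) simp
  have kN: "k \<le> ?N" unfolding k_def by (rule Least_le) simp
  have above: "y < ?b i'" if "i' < k" for i'
    using not_less_Least[of i' "\<lambda>k. k = ?N \<or> ?b k \<le> y"] that unfolding k_def by auto
  have mono: "xs ! i2 \<le> xs ! i1" if "i1 \<le> i2" "i2 < ?N" for i1 i2
    using assms(1) that sorted_wrt_nth_less[of "(\<ge>)" xs i1 i2] by (cases "i1 = i2") auto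
  have bk: "?b k < y" if "k < ?N"
    using k that assms(2) by (metis le_neq_implies_less less_irrefl mem_beta_set_iff)
  have ik: "i < k"
  proof (rule ccontr)
    assume "\<not> i < k"
    then have "k \<le> i" by simp
    then have "?b i \<le> ?b k" using mono[of k i] i(1) by linarith
    moreover have "k < ?N" using \<open>k \<le> i\<close> i(1) by simp
    ultimately show False using bk i(2) assms(3) by linarith
  qed
  have yk: "?N \<le> y + k" using bk kN by (cases "k = ?N") auto
  define j where "j = y + k - ?N"
  have j1: "j < xs ! i'" if "i' < k" for i'
  proof -
    have "j < xs ! (k - 1)" using above[of "k - 1"] ik kN yk unfolding j_def by linarith
    also have "\<dots> \<le> xs ! i'" using mono[of i' "k - 1"] that kN by linarith
    finally show ?thesis .
  qed
  have j2: "xs ! i' \<le> j" if "k \<le> i'" "i' < ?N" for i'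
  proof -
    have "xs ! k \<le> j" using bk that yk unfolding j_def by linarith
    then show ?thesis using mono[of k i'] that by linarith
  qed
  have h: "hook_length xs i j = (xs ! i - j) + (k - i - 1)"
    by (rule hook_length_eq) (use kN ik j1 j2 in auto)
  show ?thesis
  proof
    show "(i, j) \<in> cells xs" using i(1) j1[OF ik] by (simp add: cells_def)
    show "y + hook_length xs i j = x"
      using h i j1[OF ik] ik yk kN unfolding j_def by linarith
  qed
qed

text \<open>A hook of length divisible by \<open>t\<close> is a gap below a bead in the same residue class modulo \<open>t\<close>, so a
partition is a \<open>t\<close>-core when on each runner all beads are pushed down as far as possible.\<close>

lemma core_iff_flush:
  assumes "sorted_wrt (\<ge>) xs" "t > 0"
  shows "(\<forall>(i, j)\<in>cells xs. \<not> t dvd hook_length xs i j) \<longleftrightarrow> flush t (beta_set xs)"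
proof
  assume *: "\<forall>(i, j)\<in>cells xs. \<not> t dvd hook_length xs i j"
  show "flush t (beta_set xs)"
    unfolding flush_def
  proof (intro allI impI, rule ccontr)
    fix y assume "y + t \<in> beta_set xs" "y \<notin> beta_set xs"
    then obtain i j where "(i, j) \<in> cells xs" "y + hook_length xs i j = y + t"
      using gap_hook[OF assms(1), of y "y + t"] assms(2) by auto
    then show False using * by auto
  qed
next
  assume *: "flush t (beta_set xs)"
  show "\<forall>(i, j)\<in>cells xs. \<not> t dvd hook_length xs i j"
  proof (clarify)
    fix i j assume ij: "(i, j) \<in> cells xs" "t dvd hook_length xs i j"
    obtain y where y: "y \<notin> beta_set xs" "y + hook_length xs i j = xs ! i + (length xs - 1 - i)"
      using hook_gap[OF assms(1) ij(1)] .
    from ij have "i < length xs" by (simp add: cells_def)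
    then have "y + hook_length xs i j \<in> beta_set xs" unfolding y(2) by (auto simp: mem_beta_set_iff)
    moreover obtain m where "hook_length xs i j = t * m" using ij(2) ..
    ultimately show False using flush_mult[OF *] y(1) by metis
  qed
qed

lemma cells_append_zeros: "cells (xs @ replicate k 0) = cells xs"
  by (auto simp: cells_def nth_append split: if_splits)

lemma hook_length_append_zeros: "hook_length (xs @ replicate k 0) i j = hook_length xs i j"
  by (simp add: hook_length_def hook_def cells_append_zeros)

lemma sorted_append_zeros: "sorted_wrt (\<ge>) xs \<Longrightarrow> sorted_wrt (\<ge>) (xs @ replicate k (0::nat))"
proof -
  have "sorted_wrt (\<ge>) (replicate k (0::nat))" by (induction k) auto
  then show "sorted_wrt (\<ge>) xs \<Longrightarrow> ?thesis" by (simp add: sorted_wrt_append)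
qed

lemma sorted_filter_zeros:
  "sorted_wrt (\<ge>) zs \<Longrightarrow> zs = filter (\<lambda>x. x \<noteq> 0) zs @ replicate (length zs - length (filter (\<lambda>x. x \<noteq> 0) zs)) (0::nat)"
proof (induction zs)
  case (Cons z zs)
  show ?case
  proof (cases "z = 0")
    case True
    with Cons.prems have "set (z # zs) \<subseteq> {0}" by auto
    then have "z # zs = replicate (length (z # zs)) 0"
      by (intro replicate_eqI) auto
    moreover have "filter (\<lambda>x. x \<noteq> 0) (z # zs) = []" using \<open>set (z # zs) \<subseteq> {0}\<close> by (auto simp: filter_empty_conv)
    ultimately show ?thesis by simp
  next
    case False
    then show ?thesis using Cons by simp
  qed
qed simp

lemma length_le_sum_list: "0 \<notin> set xs \<Longrightarrow> length xs \<le> sum_list xs" for xs :: "nat list"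
  by (induction xs) auto

text \<open>Padding with zeros fixes the number of beads; the sum of their positions then depends only on the size of
the partition.\<close>

lemma cores_bij_flush:
  assumes "n \<le> N" "t > 0"
  shows "bij_betw (\<lambda>xs. beta_set (xs @ replicate (N - length xs) 0))
    {xs. is_core t xs \<and> sum_list xs = n}
    {X. finite X \<and> card X = N \<and> \<Sum>X = n + (N choose 2) \<and> flush t X}"
  (is "bij_betw ?f ?S ?T")
proof -
  have S: "sorted_wrt (\<ge>) (xs @ replicate (N - length xs) 0)" "length (xs @ replicate (N - length xs) 0) = N"
     "filter (\<lambda>x. x \<noteq> 0) (xs @ replicate (N - length xs) 0) = xs" if "xs \<in> ?S" for xs
  proof -
    from that have xs: "sorted_wrt (\<ge>) xs" "0 \<notin> set xs" "sum_list xs = n"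
      by (auto simp: is_core_def is_partition_def)
    then have "length xs \<le> N" using length_le_sum_list[of xs] assms by simp
    then show "length (xs @ replicate (N - length xs) 0) = N" by simp
    show "sorted_wrt (\<ge>) (xs @ replicate (N - length xs) 0)" using xs by (intro sorted_append_zeros)
    have "filter (\<lambda>x. x \<noteq> 0) xs = xs" using xs(2) by (intro filter_True ballI notI) simp
    then show "filter (\<lambda>x. x \<noteq> 0) (xs @ replicate (N - length xs) 0) = xs" by simp
  qed
  show ?thesis
    unfolding bij_betw_def
  proof
    show "inj_on ?f ?S"
    proof (rule inj_onI)
      fix xs ys assume xy: "xs \<in> ?S" "ys \<in> ?S" "?f xs = ?f ys"
      then have "xs @ replicate (N - length xs) 0 = ys @ replicate (N - length ys) 0"
        by (intro beta_set_inject) (use S[of xs] S[of ys] in simp_all)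
      then show "xs = ys" using S(3)[OF xy(1)] S(3)[OF xy(2)] by metis
    qed
    show "?f ` ?S = ?T"
    proof
      show "?f ` ?S \<subseteq> ?T"
      proof (rule image_subsetI)
        fix xs assume xs: "xs \<in> ?S"
        let ?zs = "xs @ replicate (N - length xs) 0"
        have "flush t (beta_set ?zs)"
          using xs core_iff_flush[OF S(1)[OF xs] assms(2)]
          by (simp add: is_core_def cells_append_zeros hook_length_append_zeros)
        moreover have "sum_list ?zs = n" using xs by simp
        ultimately show "?f xs \<in> ?T"
          using card_beta_set[OF S(1)[OF xs]] sum_beta_set[OF S(1)[OF xs]] S(2)[OF xs] by simp
      qed
      show "?T \<subseteq> ?f ` ?S"
      proof
        fix X assume X: "X \<in> ?T"
        then obtain zs where zs: "sorted_wrt (\<ge>) zs" "length zs = N" "beta_set zs = X"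
          using beta_set_surj[of X] by auto
        define xs where "xs = filter (\<lambda>x. x \<noteq> 0) zs"
        have eq: "zs = xs @ replicate (N - length xs) 0"
          using sorted_filter_zeros[OF zs(1)] zs(2) by (simp add: xs_def)
        have "sum_list zs = sum_list xs" by (subst eq) simp
        then have "sum_list xs = n" using sum_beta_set[OF zs(1)] zs X by simp
        moreover have "is_partition xs"
          using zs(1) unfolding is_partition_def xs_def by (auto intro: sorted_wrt_filter)
        moreover have "\<forall>(i, j)\<in>cells xs. \<not> t dvd hook_length xs i j"
        proof -
          have "cells zs = cells xs" by (subst eq) (rule cells_append_zeros)
          moreover have "hook_length zs i j = hook_length xs i j" for i j
            by (subst eq) (rule hook_length_append_zeros)
          ultimately show ?thesis using core_iff_flush[OF zs(1) assms(2)] X zs(3) by simp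
        qed
        ultimately have "xs \<in> ?S" by (simp add: is_core_def)
        moreover have "?f xs = X" using eq zs(3) by simp
        ultimately show "X \<in> ?f ` ?S" by blast
      qed
    qed
  qed
qed

section \<open>Runners of the abacus\<close>

text \<open>Runner \<open>r\<close> of the abacus carries the positions congruent to \<open>r\<close> modulo 4; its lowest \<open>c r\<close> positions
are occupied.\<close>

definition stack :: "(nat \<Rightarrow> nat) \<Rightarrow> nat set" where
  "stack c = {x. x div 4 < c (x mod 4)}"

lemma stack_runner: "r < 4 \<Longrightarrow> 4 * i + r \<in> stack c \<longleftrightarrow> i < c r"
  by (simp add: stack_def)

lemma stack_inject: "stack c = stack c' \<Longrightarrow> r < 4 \<Longrightarrow> c r = c' r"
  by (metis linorder_neqE_nat nless_le stack_runner)

lemma stack_eq: "stack c = (\<Union>r<4. (\<lambda>i. 4 * i + r) ` {..<c r})"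
proof
  show "stack c \<subseteq> (\<Union>r<4. (\<lambda>i. 4 * i + r) ` {..<c r})"
  proof
    fix x assume "x \<in> stack c"
    then have "x mod 4 < 4" "x div 4 \<in> {..<c (x mod 4)}" "x = 4 * (x div 4) + x mod 4"
      by (simp_all add: stack_def)
    then show "x \<in> (\<Union>r<4. (\<lambda>i. 4 * i + r) ` {..<c r})" by blast
  qed
  show "(\<Union>r<4. (\<lambda>i. 4 * i + r) ` {..<c r}) \<subseteq> stack c"
    using stack_runner by auto
qed

lemma finite_stack: "finite (stack c)"
  unfolding stack_eq by simp

lemma sum_stack:
  fixes f :: "nat \<Rightarrow> nat"
  shows "sum f (stack c) = (\<Sum>r<4. \<Sum>i<c r. f (4 * i + r))"
proof -
  have "sum f (stack c) = (\<Sum>r<4. sum f ((\<lambda>i. 4 * i + r) ` {..<c r}))"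
    unfolding stack_eq by (rule sum.UNION_disjoint) (auto, presburger)
  also have "\<dots> = (\<Sum>r<4. \<Sum>i<c r. f (4 * i + r))"
    by (rule sum.cong) (simp_all add: sum.reindex inj_on_def)
  finally show ?thesis .
qed

lemma card_stack: "card (stack c) = c 0 + c 1 + c 2 + c 3"
  using sum_stack[of "\<lambda>_. 1" c] by (simp add: eval_nat_numeral One_nat_def)

lemma sum_id_stack: "2 * \<Sum>(stack c) = (\<Sum>r<4. 4 * (c r * (c r - 1)) + 2 * r * c r)"
proof -
  have "2 * (\<Sum>i<m. 4 * i + r) = 4 * (m * (m - 1)) + 2 * r * m" for m r :: nat
  proof (induction m)
    case (Suc m)
    then show ?case by (cases m) (simp_all add: algebra_simps)
  qed simp
  then show ?thesis
    unfolding sum_stack by (simp add: sum_distrib_left)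
qed

lemma flush_stack: "flush 4 (stack c)"
  by (simp add: flush_def stack_def)

lemma flush_imp_stack:
  assumes "finite X" "flush 4 X"
  shows "\<exists>c. X = stack c"
proof -
  define R where "R r = {i. 4 * i + r \<in> X}" for r
  have fin: "finite (R r)" for r
  proof -
    have "inj_on (\<lambda>i. 4 * i + r) (R r)" by (simp add: inj_on_def)
    moreover have "(\<lambda>i. 4 * i + r) ` R r \<subseteq> X" by (auto simp: R_def)
    ultimately show ?thesis using assms(1) by (meson finite_imageD finite_subset)
  qed
  have R: "R r = {..<card (R r)}" for r
  proof -
    have down: "i \<in> R r" if "i + m \<in> R r" for i m
      using flush_mult[OF assms(2), of "4 * i + r" m] that by (simp add: R_def algebra_simps)
    have "i \<in> R r \<longleftrightarrow> i < card (R r)" for i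
    proof
      assume "i \<in> R r"
      then have "{..i} \<subseteq> R r" using down by (metis atMost_iff le_add_diff_inverse subsetI)
      then show "i < card (R r)" using card_mono[OF fin, of "{..i}" r] by simp
    next
      assume i: "i < card (R r)"
      show "i \<in> R r"
      proof (rule ccontr)
        assume "i \<notin> R r"
        then have "R r \<subseteq> {..<i}" using down by (metis le_add_diff_inverse lessThan_iff not_le subsetI)
        then have "card (R r) \<le> i" using card_mono[of "{..<i}" "R r"] by simp
        with i show False by simp
      qed
    qed
    then show ?thesis by auto
  qed
  have "x \<in> X \<longleftrightarrow> x div 4 < card (R (x mod 4))" for x
  proof -
    have "x \<in> X \<longleftrightarrow> x div 4 \<in> R (x mod 4)" by (simp add: R_def)
    then show ?thesis using R[of "x mod 4"] by auto
  qed
  then have "X = stack (\<lambda>r. card (R r))" by (auto simp: stack_def)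
  then show ?thesis by blast
qed

definition heights :: "nat \<Rightarrow> int \<times> int \<times> int \<Rightarrow> nat \<Rightarrow> nat" where
  "heights M = (\<lambda>(a, b, c) r. nat (int M + (if r = 0 then - (a + b + c) else if r = 1 then a else if r = 2 then b else c)))"

lemma sum_stack_core_exp:
  fixes h :: "nat \<Rightarrow> nat"
  assumes "int (h 0) = int M - (a + b + c)" "int (h 1) = int M + a" "int (h 2) = int M + b" "int (h 3) = int M + c"
  shows "card (stack h) = 4 * M" "int (\<Sum>(stack h)) = core_exp (a, b, c) + int (4 * M choose 2)"
proof -
  have "int (card (stack h)) = int (4 * M)" unfolding card_stack using assms by simp
  then show "card (stack h) = 4 * M" by linarith
  have p: "int (m * (m - 1)) = int m * (int m - 1)" for m by (cases m) (simp_all add: algebra_simps)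
  have "2 * int (\<Sum>(stack h)) = int (2 * \<Sum>(stack h))" by simp
  also have "\<dots> = 4 * (int (h 0) * (int (h 0) - 1)) + 4 * (int (h 1) * (int (h 1) - 1)) + 2 * int (h 1)
     + 4 * (int (h 2) * (int (h 2) - 1)) + 4 * int (h 2) + 4 * (int (h 3) * (int (h 3) - 1)) + 6 * int (h 3)"
    unfolding sum_id_stack p[symmetric] by (simp add: eval_nat_numeral One_nat_def)
  also have "\<dots> = 2 * core_exp (a, b, c) + int (4 * M) * (int (4 * M) - 1)"
    unfolding assms core_exp_def by (simp add: power2_eq_square algebra_simps)
  also have "int (4 * M) * (int (4 * M) - 1) = 2 * int (4 * M choose 2)"
  proof -
    have "even (4 * M * (4 * M - 1))" by simp
    then have "2 * (4 * M choose 2) = 4 * M * (4 * M - 1)" by (simp only: choose_two dvd_mult_div_cancel)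
    then show ?thesis unfolding p[symmetric] by simp
  qed
  finally show "int (\<Sum>(stack h)) = core_exp (a, b, c) + int (4 * M choose 2)" by linarith
qed

text \<open>With \<open>4 M\<close> beads in total, the shifts of the runners add up to 0. The bound on \<open>M\<close> keeps all heights
nonnegative.\<close>

lemma lattice_bij_flush:
  assumes "M \<ge> 2 * n"
  shows "bij_betw (\<lambda>v. stack (heights M v)) {v. core_exp v = int n}
    {X. finite X \<and> card X = 4 * M \<and> \<Sum>X = n + (4 * M choose 2) \<and> flush 4 X}" (is "bij_betw ?f ?S ?T")
proof -
  have h: "int (heights M (a, b, c) 0) = int M - (a + b + c)" "int (heights M (a, b, c) 1) = int M + a"
    "int (heights M (a, b, c) 2) = int M + b" "int (heights M (a, b, c) 3) = int M + c"
    if "(a, b, c) \<in> ?S" for a b c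
    using core_exp_bound[of a b c] that assms by (auto simp: heights_def)
  show ?thesis
    unfolding bij_betw_def
  proof
    show "inj_on ?f ?S"
    proof (rule inj_onI)
      fix v w assume vw: "v \<in> ?S" "w \<in> ?S" "?f v = ?f w"
      obtain a b c a' b' c' where v: "v = (a, b, c)" "w = (a', b', c')" by (cases v; cases w)
      have "heights M v r = heights M w r" if "r < 4" for r
        using stack_inject[OF vw(3) that] .
      from this[of 1] this[of 2] this[of 3] show "v = w"
        using h[of a b c] h[of a' b' c'] vw unfolding v by auto
    qed
    show "?f ` ?S = ?T"
    proof
      show "?f ` ?S \<subseteq> ?T"
      proof (rule image_subsetI)
        fix v assume v: "v \<in> ?S"
        obtain a b c where abc: "v = (a, b, c)" by (cases v)
        note s = sum_stack_core_exp[OF h[of a b c]]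
        have "int (\<Sum>(?f v)) = int (n + (4 * M choose 2))"
          using s(2) v by (simp add: abc)
        then show "?f v \<in> ?T"
          using s(1) v by (simp add: abc finite_stack flush_stack del: of_nat_sum)
      qed
      show "?T \<subseteq> ?f ` ?S"
      proof
        fix X assume X: "X \<in> ?T"
        then obtain u where u: "X = stack u" using flush_imp_stack by blast
        define a b c where "a = int (u 1) - int M" and "b = int (u 2) - int M" and "c = int (u 3) - int M"
        have "u 0 + u 1 + u 2 + u 3 = 4 * M" using X card_stack[of u] u by simp
        then have e: "int (u 0) = int M - (a + b + c)" "int (u 1) = int M + a" "int (u 2) = int M + b" "int (u 3) = int M + c"
          unfolding a_def b_def c_def by linarith+
        have "int (\<Sum>(stack u)) = int n + int (4 * M choose 2)" using X u by simp
        then have "core_exp (a, b, c) = int n"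
          using sum_stack_core_exp(2)[OF e] by linarith
        then have S: "(a, b, c) \<in> ?S" by simp
        have "heights M (a, b, c) r = u r" if "r < 4" for r
        proof -
          have "r = 0 \<or> r = 1 \<or> r = 2 \<or> r = 3" using that by linarith
          then show ?thesis using h[OF S] e by auto
        qed
        then have "stack (heights M (a, b, c)) = X" unfolding u by (simp add: stack_def)
        with S show "X \<in> ?f ` ?S" by blast
      qed
    qed
  qed
qed

lemma card_cores: "card {xs. is_core 4 xs \<and> sum_list xs = n} = card {v. core_exp v = int n}"
proof -
  have "card {xs. is_core 4 xs \<and> sum_list xs = n}
    = card {X. finite X \<and> card X = 4 * (2 * n) \<and> \<Sum>X = n + (4 * (2 * n) choose 2) \<and> flush 4 X}"
    by (rule bij_betw_same_card[OF cores_bij_flush]) simp_all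
  also have "\<dots> = card {v. core_exp v = int n}"
    by (rule bij_betw_same_card[OF lattice_bij_flush, symmetric]) simp
  finally show ?thesis .
qed

lemma A4_generating_function: "Abs_fps (\<lambda>n. of_nat (A4 n)) = core_pair_series"
proof -
  let ?S = "{xs. is_core 4 xs}" and ?Q = "\<lambda>xs :: nat list. int (sum_list xs)"
  have fin: "finite {xs \<in> ?S. ?Q xs = n}" for n
  proof (rule finite_subset)
    have nil: "is_core 4 []" by (simp add: is_core_def is_partition_def cells_def)
    show "{xs \<in> ?S. ?Q xs = n} \<subseteq> fst ` core_pairs 4 (nat n)"
    proof
      fix xs assume "xs \<in> {xs \<in> ?S. ?Q xs = n}"
      then have "(xs, []) \<in> core_pairs 4 (nat n)" using nil by (auto simp: core_pairs_def)
      then show "xs \<in> fst ` core_pairs 4 (nat n)" by force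
    qed
  qed (simp add: finite_core_pairs)
  then have adm: "admissible ?S ?Q" by (simp add: admissible_def)
  have "theta ?S ?Q = theta UNIV core_exp"
    by (rule fps_ext) (simp add: theta_nth card_cores)
  moreover have "Abs_fps (\<lambda>n. of_nat (A4 n)) = theta ?S ?Q * theta ?S ?Q"
    unfolding theta_mult[OF adm adm]
  proof (rule fps_ext)
    fix n
    have "core_pairs 4 n = {p \<in> ?S \<times> ?S. (case p of (xs, ys) \<Rightarrow> ?Q xs + ?Q ys) = int n}"
      by (auto simp: core_pairs_def)
    then show "Abs_fps (\<lambda>n. of_nat (A4 n)) $ n = theta (?S \<times> ?S) (\<lambda>(xs, ys). ?Q xs + ?Q ys) $ n"
      by (simp add: theta_nth A4_def)
  qed
  ultimately have "Abs_fps (\<lambda>n. of_nat (A4 n)) = (psi * psi2 ^ 2) * (psi * psi2 ^ 2)"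
    by (simp only: theta_core_exp)
  then show ?thesis
    unfolding core_pair_series_def by algebra
qed

section \<open>Pairs of 4-cores along the progressions\<close>

theorem theorem1p1:
  fixes k :: nat
  shows "Abs_fps (\<lambda>n. of_nat (A4 (3 ^ (2 * k + 1) * n + (3 ^ (2 * k + 2) - 5) div 4))) =
    fps_const ((3 ^ (2 * k + 2) - 1) / 4) * (euler_f 2 ^ 12 / euler_f 1 ^ 6)
    + fps_const (27 * (3 ^ (2 * k) - 1) * (3 ^ (2 * k + 2) - 1) / 320) *
        (3 * (euler_f 2 ^ 2 * euler_f 3 ^ 10 / (euler_f 1 ^ 4 * euler_f 6 ^ 2))
         + 4 * fps_X * (euler_f 3 * euler_f 6 ^ 7 / (euler_f 1 * euler_f 2)))
    + 3 ^ (2 * k + 2) * (fps_X ^ 3 * euler_f 12 ^ 8 / euler_f 3 ^ 2)"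
proof -
  let ?S = "\<lambda>k. Abs_fps (\<lambda>n. of_nat (A4 (3 ^ (2 * k + 1) * n + (3 ^ (2 * k + 2) - 5) div 4))) :: complex fps"
  have S0: "?S 0 = section3 1 core_pair_series"
    unfolding A4_generating_function[symmetric] by (simp add: section3_def)
  have step: "?S (Suc k) = section9 (?S k)" for k
  proof (rule fps_ext)
    fix n
    have "4 * ((3 ^ (2 * Suc k + 2) - 5) div 4) + 5 =
      4 * (3 ^ (2 * k + 1) * 6 + (3 ^ (2 * k + 2) - 5) div 4) + (5::nat)"
      using shift_exact[of k] shift_exact[of "Suc k"] by (simp add: power_add)
    then have "3 ^ (2 * Suc k + 1) * n + (3 ^ (2 * Suc k + 2) - 5) div 4 =
      3 ^ (2 * k + 1) * (9 * n + 6) + (3 ^ (2 * k + 2) - 5) div (4::nat)"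
      by (simp add: power_add algebra_simps)
    then show "?S (Suc k) $ n = section9 (?S k) $ n"
      by (simp add: section9_nth)
  qed
  have "fps_X ^ 3 * euler_f 12 ^ 8 / euler_f 3 ^ 2 = fps_X ^ 3 * dilate 3 core_pair_series"
    unfolding core_pair_series_euler_f
    by (simp add: fps_divide_unit euler_f_nth_0 fps_nth_power_0 mult.assoc)
  moreover have "fps_const (3 ^ (2 * k + 2)) = (3 ^ (2 * k + 2) :: complex fps)"
    by (simp add: numeral_fps_const fps_const_power)
  ultimately show ?thesis
    using section9_iterates[of ?S k, OF S0 step] by (simp only: psi_6_euler_f eigen_series_def)
qed

end
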